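(* Let $\chi>0$ and let $\{p_n\}$, $\{s_n\}$ be the monic Legendre and monic Sobolev-Legendre orthogonal polynomials generated from the $k=1$ family of monomials. For $n\ge1$ let $f_n(x)=-\int_{SG}G(x,y)p_{n-1}(y)\,d\mu(y)$. Then for every $n\ge1$ $$\|p_n\|_2^2+\chi\|p_{n-1}\|_2^2\le\|s_n\|_S^2\le2\|G\|_2^2\|p_{n-1}\|_2^2+\left(\partial_nf_n(q_0)\right)^2+\chi\|p_{n-1}\|_2^2,$$ $$\|p_n\|_2\le\|s_n\|_2\le\|G\|_2\|p_{n-1}\|_2+\left|\partial_nf_n(q_0)\right|,$$ where $\partial_nf_n(q_0)$ is the normal derivative of $f_n$ at $q_0$.
   Context: Sierpinski gasket: let $q_0=(\tfrac12,\tfrac{\sqrt3}{2})$, $q_1=(0,0)$, $q_2=(1,0)$, $V_0=\{q_0,q_1,q_2\}$, $F_i(x)=\tfrac12(x-q_i)+q_i$, and let $SG\subset\mathbb R^2$ be the unique nonempty compact set with $SG=\bigcup_{i=0}^2F_i(SG)$. For a word $w=(w_1,\dots,w_m)\in\{0,1,2\}^m$, $|w|=m$, put $F_w=F_{w_1}\circ\cdots\circ F_{w_m}$; $F_w(SG)$ is called an $m$-cell; $V_m=\bigcup_{|w|=m}F_w(V_0)$; distinct $x,y\in V_m$ satisfy $x\sim_m y$ if they lie in a common $m$-cell. $\mu$ is the self-similar Borel probability measure with $\mu(F_w(SG))=3^{-|w|}$. All functions are real-valued. Energy and Laplacian: $\mathscr E(u,v)=\lim_{m\to\infty}(3/5)^{-m}\sum_{x\sim_m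 y}(u(x)-u(y))(v(x)-v(y))$ (sum over unordered pairs), and $u\in\operatorname{dom}\mathscr E$ if $\mathscr E(u,u)$ exists and is finite. For $u\in\operatorname{dom}\mathscr E$ and $f$ continuous, $\Delta u=f$ means $\mathscr E(u,v)=-\int_{SG}fv\,d\mu$ for all $v\in\operatorname{dom}\mathscr E$ vanishing on $V_0$. Indices of $q_i$ are mod 3. Normal derivative: $\partial_nu(q_i)=\lim_m(5/3)^m(2u(q_i)-u(F_i^mq_{i+1})-u(F_i^mq_{i-1}))$. Tangential derivative: $\partial_Tu(q_i)=\lim_m5^m(u(F_i^mq_{i+1})-u(F_i^mq_{i-1}))$. Green's function: $G(x,y)$ is the (continuous, symmetric) Green's function of the Dirichlet problem: for $f$ continuous, $-\Delta u=f$ and $u|_{V_0}=0$ iff $u(x)=\int_{SG}G(x,y)f(y)\,d\mu(y)$. $\|G\|_2$ is the norm of $G$ in $L^2(SG\times SG,\mu\times\mu)$. Monomials: for $j\ge0$, $k\in\{1,2,3\}$, $P_{j,k}$ is the unique function with $\Delta^{j+1}P_{j,k}=0$ such that for all $0\le n\le j$: $\Delta^nP_{j,k}(q_0)=\delta_{nj}\delta_{k1}$, $\partial_n\Delta^nP_{j,k}(q_0)=\delta_{nj}\delta_{k2}$, $\partial_T\Delta^nP_{j,k}(q_0)=\delta_{nj}\delta_{k3}$. In particular $\Delta P_{j,k}=P_{j-1,k}$ with $P_{-1,k}=0$. Inner products: $\langle f,g\rangle_2=\int_{SG}fg\,d\mu$ with norm $\|\cdot\|_2$; $\langle f,g\rangle_S=\int_{SG}fg\,d\mu+\chi\int_{SG}\Delta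 f\,\Delta g\,d\mu$ with norm $\|\cdot\|_S$. For $k=1$, $\{p_{n}\}$ (monic Legendre) and $\{s_{n}\}$ (monic Sobolev-Legendre) are obtained from $P_{0,1},P_{1,1},\dots$ by Gram-Schmidt without normalization with respect to $\langle\cdot,\cdot\rangle_2$ and $\langle\cdot,\cdot\rangle_S$ respectively; i.e. each of $p_{n}$, $s_{n}$ equals $P_{n,1}$ plus a linear combination of $P_{0,1},\dots,P_{n-1,1}$ and is orthogonal to $P_{0,1},\dots,P_{n-1,1}$. *)

theory Defs
  imports "HOL-Probability.Probability"
begin

text \<open>
  Functions on the gasket are total functions on the plane of which only the values on \<open>SG\<close>
  matter; the index type \<open>3\<close> carries arithmetic modulo 3.
\<close>

type_synonym point = "real \<times> real"

subsection \<open>The gasket\<close>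

definition q :: "3 \<Rightarrow> point" where
  "q i = (if i = 0 then (1/2, sqrt 3 / 2) else if i = 1 then (0, 0) else (1, 0))"

definition V0 :: "point set" where
  "V0 = range q"

definition F :: "3 \<Rightarrow> point \<Rightarrow> point" where
  "F i x = (1/2) *\<^sub>R (x - q i) + q i"

definition SG :: "point set" where
  "SG = (THE K. compact K \<and> K \<noteq> {} \<and> K = (\<Union>i. F i ` K))"

lemma dist_F: "dist (F i x) (F i y) = dist x y / 2"
proof -
  have "F i x - F i y = (1/2) *\<^sub>R (x - y)" by (simp add: F_def algebra_simps)
  then show ?thesis by (simp add: dist_norm)
qed

lemma continuous_on_F: "continuous_on A (F i)"
  unfolding F_def by (intro continuous_intros)

lemma inj_F: "inj (F i)"
  by (auto simp: inj_on_def F_def)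

lemma invariant_subset:
  assumes K: "compact K" "K \<noteq> {}" "K = (\<Union>i. F i ` K)"
    and L: "compact L" "L \<noteq> {}" "L = (\<Union>i. F i ` L)"
  shows "K \<subseteq> L"
proof -
  obtain a where a: "a \<in> K" "\<And>x. x \<in> K \<Longrightarrow> infdist x L \<le> infdist a L"
    using continuous_attains_sup[OF K(1,2) continuous_on_infdist[OF continuous_on_id]] by blast
  have "a \<in> (\<Union>i. F i ` K)" using a(1) K(3) by (rule subst[rotated])
  then obtain i b where b: "b \<in> K" "a = F i b" by blast
  obtain c where c: "c \<in> L" "infdist b L = dist b c"
    using infdist_attains_inf[OF compact_imp_closed[OF L(1)] L(2)] by metis
  have "F i c \<in> (\<Union>i. F i ` L)" using c(1) by blast
  with L(3) have "F i c \<in> L" by (rule ssubst)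
  then have "infdist a L \<le> infdist b L / 2"
    using infdist_le[of "F i c" L a] b(2) c(2) by (simp add: dist_F)
  then have "infdist a L \<le> 0" using a(2)[OF b(1)] by simp
  then have "infdist x L = 0" if "x \<in> K" for x
    using a(2)[OF that] infdist_nonneg[of x L] by linarith
  then show ?thesis
    using in_closed_iff_infdist_zero[OF compact_imp_closed[OF L(1)] L(2)] by blast
qed

lemma SG_ex: "\<exists>K. compact K \<and> K \<noteq> {} \<and> K = (\<Union>i. F i ` K)"
proof -
  define H where "H A = (\<Union>i. F i ` A)" for A
  define K where "K m = (H ^^ m) (cball 0 1)" for m
  have K0: "K 0 = cball 0 1" and KS: "K (Suc m) = H (K m)" for m by (auto simp: K_def)
  have Hmono: "H A \<subseteq> H B" if "A \<subseteq> B" for A B using that by (auto simp: H_def)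
  have nq: "norm (q i) \<le> 1" for i
    by (auto simp: q_def norm_Pair power_divide)
  have "K (Suc 0) \<subseteq> K 0"
  proof
    fix x assume "x \<in> K (Suc 0)"
    then obtain i y where y: "norm y \<le> 1" "x = F i y" by (auto simp: KS K0 H_def)
    have "x = (1/2) *\<^sub>R (y + q i)"
      unfolding y(2) F_def by (rule prod_eqI) (simp_all add: field_simps)
    then have "norm x \<le> 1" using norm_triangle_ineq[of y "q i"] nq[of i] y(1) by simp
    then show "x \<in> K 0" by (simp add: K0)
  qed
  then have step: "K (Suc m) \<subseteq> K m" for m
    by (induction m) (simp_all add: KS Hmono)
  have anti: "K n \<subseteq> K m" if "m \<le> n" for m n
    using lift_Suc_antimono_le[of K, OF step that] .
  have comp: "compact (K m)" for m
  proof (induction m)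
    case (Suc m)
    then show ?case unfolding KS H_def
      by (intro compact_UN finite_class.finite_UNIV compact_continuous_image continuous_on_F)
  qed (simp add: K0)
  have ne: "K m \<noteq> {}" for m by (induction m) (auto simp: KS K0 H_def)
  define C where "C = (\<Inter>m. K m)"
  have "C \<noteq> {}" unfolding C_def by (rule compact_nest[OF comp ne anti])
  moreover have "compact C" unfolding C_def
    by (intro compact_Inter) (use comp in auto)
  moreover have "H C \<subseteq> C"
  proof -
    have "H C \<subseteq> K (Suc m)" for m unfolding KS by (rule Hmono) (auto simp: C_def)
    then show ?thesis using step unfolding C_def by blast
  qed
  moreover have "C \<subseteq> H C"
  proof
    fix x assume x: "x \<in> C"
    have "\<exists>i. \<forall>m. x \<in> F i ` K m"
    proof (rule ccontr)
      assume "\<not> ?thesis"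
      then obtain m where m: "\<And>i. x \<notin> F i ` K (m i)" by metis
      have "x \<in> K (Suc (Max (range m)))" using x by (auto simp: C_def)
      then obtain i where "x \<in> F i ` K (Max (range m))" by (auto simp: KS H_def)
      moreover have "K (Max (range m)) \<subseteq> K (m i)" by (rule anti) simp
      ultimately show False using m[of i] by blast
    qed
    then obtain i where i: "\<And>m. x \<in> F i ` K m" by blast
    then obtain y where y: "x = F i y" by blast
    have "y \<in> C" using i inj_F[of i] unfolding C_def y by (auto simp: inj_image_mem_iff)
    then show "x \<in> H C" using y by (auto simp: H_def)
  qed
  ultimately show ?thesis unfolding H_def by blast
qed

lemma SG_ex1: "\<exists>!K. compact K \<and> K \<noteq> {} \<and> K = (\<Union>i. F i ` K)"
proof (rule ex_ex1I[OF SG_ex])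
  fix K L :: "point set"
  assume K: "compact K \<and> K \<noteq> {} \<and> K = (\<Union>i. F i ` K)"
    and L: "compact L \<and> L \<noteq> {} \<and> L = (\<Union>i. F i ` L)"
  show "K = L"
  proof (rule subset_antisym)
    show "K \<subseteq> L"
      using K L by (elim conjE) (rule invariant_subset)
    show "L \<subseteq> K"
      using K L by (elim conjE) (rule invariant_subset)
  qed
qed

lemma SG_properties: "compact SG \<and> SG \<noteq> {} \<and> SG = (\<Union>i. F i ` SG)"
  unfolding SG_def by (rule theI'[OF SG_ex1])

definition F_word :: "3 list \<Rightarrow> point \<Rightarrow> point" where
  "F_word w = foldr (\<lambda>i g. F i \<circ> g) w id"

definition V :: "nat \<Rightarrow> point set" where
  "V m = (\<Union>w\<in>{w. length w = m}. F_word w ` V0)"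

definition adj :: "nat \<Rightarrow> point \<Rightarrow> point \<Rightarrow> bool" where
  "adj m x y \<longleftrightarrow> x \<in> V m \<and> y \<in> V m \<and> x \<noteq> y \<and>
     (\<exists>w. length w = m \<and> x \<in> F_word w ` SG \<and> y \<in> F_word w ` SG)"

text \<open>The space of the measure is \<open>SG\<close> itself, so that integrals ignore values off \<open>SG\<close>.\<close>

definition sg_measure :: "point measure \<Rightarrow> bool" where
  "sg_measure M \<longleftrightarrow> sets M = sets (restrict_space borel SG) \<and> prob_space M \<and>
     (\<forall>A\<in>sets M. measure M A = (\<Sum>i\<in>UNIV. (1/3) * measure M (F i -` A \<inter> SG))) \<and>
     (\<forall>w. measure M (F_word w ` SG) = (1/3) ^ length w)"

subsection \<open>Energy and Laplacian\<close>

text \<open>Every unordered pair occurs twice in the sum, whence the factor 1/2.\<close>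

definition energy_level :: "nat \<Rightarrow> (point \<Rightarrow> real) \<Rightarrow> (point \<Rightarrow> real) \<Rightarrow> real" where
  "energy_level m u v =
     (5/3) ^ m * ((1/2) * (\<Sum>(x, y)\<in>{(x, y). adj m x y}. (u x - u y) * (v x - v y)))"

definition energy :: "(point \<Rightarrow> real) \<Rightarrow> (point \<Rightarrow> real) \<Rightarrow> real" where
  "energy u v = lim (\<lambda>m. energy_level m u v)"

text \<open>
  The energy only sees the values on the countable set of vertices; as usual, functions of finite
  energy are understood to be continuous.
\<close>

definition dom_energy :: "(point \<Rightarrow> real) set" where
  "dom_energy = {u. continuous_on SG u \<and> convergent (\<lambda>m. energy_level m u u)}"

definition has_laplacian :: "point measure \<Rightarrow> (point \<Rightarrow> real) \<Rightarrow> (point \<Rightarrow> real) \<Rightarrow> bool" where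
  "has_laplacian M u f \<longleftrightarrow> u \<in> dom_energy \<and> continuous_on SG f \<and>
     (\<forall>v\<in>dom_energy. (\<forall>x\<in>V0. v x = 0) \<longrightarrow> energy u v = - (\<integral>x. f x * v x \<partial>M))"

text \<open>Off \<open>SG\<close> the value of the operator is normalised to 0, to single out one representative.\<close>

definition laplacian :: "point measure \<Rightarrow> (point \<Rightarrow> real) \<Rightarrow> point \<Rightarrow> real" where
  "laplacian M u = (THE f. has_laplacian M u f \<and> (\<forall>x. x \<notin> SG \<longrightarrow> f x = 0))"

definition has_normal_deriv :: "(point \<Rightarrow> real) \<Rightarrow> 3 \<Rightarrow> real \<Rightarrow> bool" where
  "has_normal_deriv u i d \<longleftrightarrow>
     (\<lambda>m. (5/3) ^ m * (2 * u (q i) - u ((F i ^^ m) (q (i + 1))) - u ((F i ^^ m) (q (i - 1)))))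
       \<longlonglongrightarrow> d"

definition normal_deriv :: "(point \<Rightarrow> real) \<Rightarrow> 3 \<Rightarrow> real" where
  "normal_deriv u i = (THE d. has_normal_deriv u i d)"

definition has_tangential_deriv :: "(point \<Rightarrow> real) \<Rightarrow> 3 \<Rightarrow> real \<Rightarrow> bool" where
  "has_tangential_deriv u i d \<longleftrightarrow>
     (\<lambda>m. 5 ^ m * (u ((F i ^^ m) (q (i + 1))) - u ((F i ^^ m) (q (i - 1))))) \<longlonglongrightarrow> d"

subsection \<open>Green's function\<close>

definition is_green :: "point measure \<Rightarrow> (point \<Rightarrow> point \<Rightarrow> real) \<Rightarrow> bool" where
  "is_green M G \<longleftrightarrow>
     continuous_on (SG \<times> SG) (\<lambda>(x, y). G x y) \<and>
     (\<forall>x\<in>SG. \<forall>y\<in>SG. G x y = G y x) \<and>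
     (\<forall>f u. continuous_on SG f \<longrightarrow>
        (has_laplacian M u (\<lambda>x. - f x) \<and> (\<forall>x\<in>V0. u x = 0) \<longleftrightarrow>
         (\<forall>x\<in>SG. u x = (\<integral>y. G x y * f y \<partial>M))))"

definition green_norm :: "point measure \<Rightarrow> (point \<Rightarrow> point \<Rightarrow> real) \<Rightarrow> real" where
  "green_norm M G = sqrt (\<integral>(x, y). (G x y)\<^sup>2 \<partial>(M \<Otimes>\<^sub>M M))"

subsection \<open>Monomials and orthogonal polynomials\<close>

text \<open>
  The first conjunct says that \<open>f\<close> lies in the domain of the \<open>j + 1\<close>-st power of the Laplacian;
  without it the iterates of \<^const>\<open>laplacian\<close> would carry no information.
\<close>

definition is_monomial :: "point measure \<Rightarrow> nat \<Rightarrow> nat \<Rightarrow> (point \<Rightarrow> real) \<Rightarrow> bool" where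
  "is_monomial M j k f \<longleftrightarrow> k \<in> {1, 2, 3} \<and>
     (\<forall>n\<le>j. \<exists>g. has_laplacian M ((laplacian M ^^ n) f) g) \<and>
     (\<forall>x\<in>SG. (laplacian M ^^ (j + 1)) f x = 0) \<and>
     (\<forall>n\<le>j. (laplacian M ^^ n) f (q 0) = of_bool (n = j \<and> k = 1) \<and>
        has_normal_deriv ((laplacian M ^^ n) f) 0 (of_bool (n = j \<and> k = 2)) \<and>
        has_tangential_deriv ((laplacian M ^^ n) f) 0 (of_bool (n = j \<and> k = 3)))"

definition inner_L2 :: "point measure \<Rightarrow> (point \<Rightarrow> real) \<Rightarrow> (point \<Rightarrow> real) \<Rightarrow> real" where
  "inner_L2 M f g = (\<integral>x. f x * g x \<partial>M)"

definition norm_L2 :: "point measure \<Rightarrow> (point \<Rightarrow> real) \<Rightarrow> real" where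
  "norm_L2 M f = sqrt (inner_L2 M f f)"

definition inner_S :: "point measure \<Rightarrow> real \<Rightarrow> (point \<Rightarrow> real) \<Rightarrow> (point \<Rightarrow> real) \<Rightarrow> real" where
  "inner_S M c f g =
     (\<integral>x. f x * g x \<partial>M) + c * (\<integral>x. laplacian M f x * laplacian M g x \<partial>M)"

definition norm_S :: "point measure \<Rightarrow> real \<Rightarrow> (point \<Rightarrow> real) \<Rightarrow> real" where
  "norm_S M c f = sqrt (inner_S M c f f)"

text \<open>The output of Gram-Schmidt without normalisation applied to \<open>P 0, P 1, \<dots>\<close>.\<close>

definition monic_orthogonal ::
  "((point \<Rightarrow> real) \<Rightarrow> (point \<Rightarrow> real) \<Rightarrow> real) \<Rightarrow> (nat \<Rightarrow> point \<Rightarrow> real) \<Rightarrow> (nat \<Rightarrow> point \<Rightarrow> real) \<Rightarrow> bool"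
  where
  "monic_orthogonal ip P r \<longleftrightarrow>
     (\<forall>n. (\<exists>a. \<forall>x\<in>SG. r n x = P n x + (\<Sum>i<n. a i * P i x)) \<and> (\<forall>m<n. ip (r n) (P m) = 0))"

end

theory Submission
  imports Defs
begin

text \<open>
  The polynomials \<open>p\<^sub>n\<close> and \<open>s\<^sub>n\<close> minimise their norms among the monic polynomials of degree \<open>n\<close>,
  and the Laplacian of a monic polynomial of degree \<open>n\<close> is monic of degree \<open>n - 1\<close>; this gives the
  lower bounds. For the upper bounds, compare \<open>s\<^sub>n\<close> with a monic \<open>Q\<close> whose Laplacian is
  \<open>p\<^sub>n\<^sub>-\<^sub>1\<close>. Then \<open>Q - f\<^sub>n\<close> is harmonic and vanishes at \<open>q\<^sub>0\<close>, and since the \<open>k = 1\<close> monomials are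
  symmetric under the reflection fixing \<open>q\<^sub>0\<close> and have normal derivative 0 there, both of its other
  boundary values are half the normal derivative of \<open>f\<^sub>n\<close> at \<open>q\<^sub>0\<close>.

  Uniqueness for the Dirichlet problem is contained in the existence of a Green's function. Hence a
  function with Laplacian 0 equals the explicit self-similar extension of its boundary values, and
  multiharmonic functions are determined by their jets at \<open>q\<^sub>0\<close>.
\<close>


text \<open>Two features of the setting shape the work. The Laplacian is defined weakly and
  \<open>laplacian\<close> is a definite description, so nothing can be said about it before
  uniqueness is known. That requires a test function in \<open>dom_energy\<close>, zero on
  \<open>V0\<close>, nonnegative and of positive integral, and a way to use it inside arbitrarily
  small cells; hence the construction of harmonic functions, their products, and the gluing of
  functions along cells. Moreover, the measure is known through its self-similarity, so its
  reflection invariance, on which the symmetry of the monomials rests, is derived by subdivision.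
  The finite approximations of the energy obey an exact self-similar formula, so most facts about
  them are inductions on the level.\<close>

section \<open>Arithmetic of indices modulo 3\<close>

lemma neq_3 [simp]: "(0::3) \<noteq> 1" "(0::3) \<noteq> 2" "(1::3) \<noteq> 2"
  "(1::3) \<noteq> 0" "(2::3) \<noteq> 0" "(2::3) \<noteq> 1"
proof -
  show *: "(2::3) \<noteq> 0"
  proof
    assume "(2::3) = 0"
    then have "iszero (2::3)" by (simp only: iszero_def)
    then show False unfolding bit1_iszero_numeral by simp
  qed
  then show "(0::3) \<noteq> 2" by metis
  show "(0::3) \<noteq> 1" "(1::3) \<noteq> 0" by (rule zero_neq_one one_neq_zero)+
  show **: "(1::3) \<noteq> 2"
  proof
    assume "(1::3) = 2"
    then have "(1::3) = 1 + 1" by (simp only: one_add_one)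
    then have "(1::3) = 0" using add_cancel_right_right by blast
    then show False using one_neq_zero by blast
  qed
  then show "(2::3) \<noteq> 1" by metis
qed

lemma UNIV_3_eq: "(UNIV :: 3 set) = {0, 1, 2}"
proof -
  have "(3::3) = 0" by simp
  then have "x = 0 \<or> x = 1 \<or> x = 2" for x :: 3
    using exhaust_3[of x] by metis
  then show ?thesis by blast
qed

lemma exhaust_3_cases: "(i::3) = 0 \<or> i = 1 \<or> i = 2"
  using UNIV_3_eq by blast

lemma sum_UNIV_3: "sum g (UNIV :: 3 set) = g 0 + g 1 + g 2"
  for g :: "3 \<Rightarrow> 'a::comm_monoid_add"
  unfolding UNIV_3_eq by (simp add: add.assoc)

lemma minus_3: "- (0::3) = 0" "- (1::3) = 2" "- (2::3) = 1"
proof -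
  have "(2::3) + 1 = 0" by simp
  then have "(2::3) = - 1" using eq_neg_iff_add_eq_0 by blast
  then show "- (1::3) = 2" "- (2::3) = 1" by (metis, metis minus_minus)
qed simp

subsection \<open>Geometry of the gasket\<close>

lemma SG_compact: "compact SG" and SG_ne: "SG \<noteq> {}" and SG_eq: "SG = (\<Union>i. F i ` SG)"
  using SG_properties by blast+

lemma SG_unique:
  assumes "compact K" "K \<noteq> {}" "K = (\<Union>i. F i ` K)"
  shows "K = SG"
  using assms SG_properties invariant_subset by (metis subset_antisym)

lemma F_in_SG [simp, intro]: "x \<in> SG \<Longrightarrow> F i x \<in> SG"
  using SG_eq by blast

lemma SG_cases:
  assumes "x \<in> SG"
  obtains i y where "y \<in> SG" "x = F i y"
  using assms SG_eq by blast

text \<open>Barycentric coordinates of the triangle with vertices \<open>q i\<close>. In them every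
  \<open>F i\<close> acts by halving and adding 1/2 to coordinate \<open>i\<close>, so the geometry
  of the cells reduces to arithmetic free of square roots.\<close>

definition bary :: "3 \<Rightarrow> point \<Rightarrow> real" where
  "bary k x = (if k = 0 then 2 * snd x / sqrt 3
     else if k = 1 then 1 - fst x - snd x / sqrt 3 else fst x - snd x / sqrt 3)"

lemma bary_q: "bary k (q i) = of_bool (k = i)"
  using exhaust_3_cases[of k] exhaust_3_cases[of i] by (auto simp: bary_def q_def)

lemma bary_F: "bary k (F i x) = (bary k x + of_bool (k = i)) / 2"
  using exhaust_3_cases[of k] exhaust_3_cases[of i]
  by (auto simp: bary_def q_def F_def field_simps)

lemma bary_sum: "bary 0 x + bary 1 x + bary 2 x = 1"
  by (simp add: bary_def field_simps)

lemma bary_inject: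
  assumes "\<And>k. bary k x = bary k y"
  shows "x = y"
proof -
  have "snd x = snd y" using assms[of 0] by (simp add: bary_def)
  moreover have "fst x = fst y" using assms[of 2] calculation by (simp add: bary_def)
  ultimately show ?thesis by (simp add: prod_eq_iff)
qed

lemma continuous_on_bary: "continuous_on A (bary k)"
  using exhaust_3_cases[of k] unfolding bary_def by (auto intro!: continuous_intros)

text \<open>Take a minimiser and write it as \<open>F i b\<close>: its coordinate is at least half
  that of \<open>b\<close>, hence at least half the minimum itself, so the minimum cannot be
  negative.\<close>

lemma bary_nonneg:
  assumes "x \<in> SG"
  shows "bary k x \<ge> 0"
proof -
  obtain a where a: "a \<in> SG" "\<And>x. x \<in> SG \<Longrightarrow> bary k a \<le> bary k x"
    using continuous_attains_inf[OF SG_compact SG_ne continuous_on_bary] by blast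
  obtain i b where b: "b \<in> SG" "a = F i b" using a(1) by (rule SG_cases)
  have "bary k a \<ge> bary k b / 2" unfolding b(2) bary_F by simp
  then have "bary k a \<ge> 0" using a(2)[OF b(1)] by simp
  then show ?thesis using a(2)[OF assms] by simp
qed

lemma F_q_commute: "F i (q j) = F j (q i)"
  by (rule bary_inject) (simp add: bary_F bary_q)

lemma F_q_self [simp]: "F i (q i) = q i"
  by (simp add: F_def)

text \<open>Coordinate \<open>i\<close> is at least 1/2 in cell \<open>i\<close>, and at
  \<open>F j y\<close> it is half the coordinate of \<open>y\<close>. So \<open>y\<close> has
  coordinate \<open>i\<close> at least 1, which leaves only the vertex \<open>q i\<close>.\<close>

lemma F_meet:
  assumes "i \<noteq> j" "x \<in> SG" "y \<in> SG" "F i x = F j y"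
  shows "x = q j" "y = q i"
proof -
  have *: "y = q i" if "i \<noteq> j" "x \<in> SG" "y \<in> SG" "F i x = F j y" for i j x y
  proof (rule bary_inject)
    fix k
    have "bary i (F i x) = bary i (F j y)" using that by simp
    then have "bary i y \<ge> 1" using that(1) bary_nonneg[OF that(2), of i] by (simp add: bary_F)
    then show "bary k y = bary k (q i)"
      using bary_sum[of y] bary_nonneg[OF that(3), of 0] bary_nonneg[OF that(3), of 1]
        bary_nonneg[OF that(3), of 2] exhaust_3_cases[of i] exhaust_3_cases[of k]
      by (auto simp: bary_q)
  qed
  show "y = q i" using assms by (rule *)
  show "x = q j" by (rule *[of j i y x]) (use assms in auto)
qed

lemma inj_q: "q i = q j \<Longrightarrow> i = j"
  using bary_q[of i i] bary_q[of i j] by (auto split: if_splits)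

lemma F_eq_iff [simp]: "F i x = F i y \<longleftrightarrow> x = y"
  by (rule inj_eq[OF inj_F])

text \<open>The point of \<open>SG\<close> closest to \<open>q i\<close> is moved by
  \<open>F i\<close> to a point of \<open>SG\<close> at half the distance, so that distance is
  0.\<close>

lemma q_in_SG [simp, intro]: "q i \<in> SG"
proof -
  have "\<exists>a\<in>SG. \<forall>x\<in>SG. dist a (q i) \<le> dist x (q i)"
    by (rule continuous_attains_inf[OF SG_compact SG_ne]) (intro continuous_intros)
  then obtain a where a: "a \<in> SG" "\<And>x. x \<in> SG \<Longrightarrow> dist a (q i) \<le> dist x (q i)"
    by blast
  have "dist (F i a) (q i) = dist a (q i) / 2"
    using dist_F[of i a "q i"] by simp
  then have "dist a (q i) \<le> 0" using a(2)[OF F_in_SG[OF a(1), of i]] by linarith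
  then have "a = q i" by simp
  then show ?thesis using a(1) by simp
qed

lemma F_word_Nil [simp]: "F_word [] = id" and F_word_Cons [simp]: "F_word (i # w) = F i \<circ> F_word w"
  by (simp_all add: F_word_def)

lemma F_word_in_SG [simp, intro]: "x \<in> SG \<Longrightarrow> F_word w x \<in> SG"
  by (induction w) auto

lemma V_0 [simp]: "V 0 = V0"
  by (simp add: V_def)

lemma words_Suc: "{w. length w = Suc m} = (\<Union>i. (#) i ` {w. length w = m})"
  by (auto simp: length_Suc_conv image_iff)

lemma V_Suc: "V (Suc m) = (\<Union>i. F i ` V m)"
  unfolding V_def words_Suc by (auto simp: image_iff) metis+

lemma q_in_V0 [simp, intro]: "q i \<in> V0"
  by (simp add: V0_def)

lemma q_in_V: "q i \<in> V m"
proof (induction m)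
  case (Suc m)
  then have "F i (q i) \<in> V (Suc m)" unfolding V_Suc by blast
  then show ?case by simp
qed simp

lemma V_subset_SG: "V m \<subseteq> SG"
  by (induction m) (auto simp: V_Suc V0_def)

lemma finite_V: "finite (V m)"
  by (induction m) (simp_all add: V_Suc V0_def)

lemma finite_adj: "finite {(x, y). adj m x y}"
  by (rule finite_subset[OF _ finite_cartesian_product[OF finite_V[of m] finite_V[of m]]])
    (auto simp: adj_def)

text \<open>The vertex may have arisen from another cell \<open>j\<close>; in that case it is a
  junction point and \<open>x\<close> is \<open>q j\<close>, which belongs to every level.\<close>

lemma V_Suc_cell:
  assumes "F i x \<in> V (Suc m)" "x \<in> SG"
  shows "x \<in> V m"
proof -
  obtain j z where z: "z \<in> V m" "F i x = F j z" using assms(1) unfolding V_Suc by blast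
  show ?thesis
  proof (cases "i = j")
    case False
    then have "x = q j" using F_meet(1)[of i j x z] z V_subset_SG assms(2) by blast
    then show ?thesis using q_in_V by simp
  qed (use z in auto)
qed

lemma adj_SG: "adj m x y \<Longrightarrow> x \<in> SG \<and> y \<in> SG \<and> x \<noteq> y"
  using V_subset_SG[of m] by (simp add: adj_def subset_iff del: split_paired_All)

lemma adj_0: "adj 0 x y \<longleftrightarrow> x \<in> V0 \<and> y \<in> V0 \<and> x \<noteq> y"
  using V_subset_SG[of 0] by (auto simp: adj_def)

text \<open>Recursion over the first letter of the word. It makes the edge sums self-similar, so
  that facts on the energy can be proved by induction on the level.\<close>

lemma adj_Suc:
  "{(x, y). adj (Suc m) x y} = (\<Union>i. map_prod (F i) (F i) ` {(x, y). adj m x y})" (is "?L = ?R")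
proof
  show "?L \<subseteq> ?R"
  proof
    fix z assume "z \<in> ?L"
    then obtain x y where z: "z = (x, y)" and "adj (Suc m) x y" by blast
    then obtain w where w: "length w = Suc m" "x \<in> F_word w ` SG" "y \<in> F_word w ` SG"
      and xy: "x \<in> V (Suc m)" "y \<in> V (Suc m)" "x \<noteq> y"
      unfolding adj_def by blast
    obtain i v where v: "w = i # v" "length v = m" using w(1) by (auto simp: length_Suc_conv)
    obtain x' y' where x': "x = F i x'" "x' \<in> F_word v ` SG" and y': "y = F i y'" "y' \<in> F_word v ` SG"
      using w(2,3) unfolding v(1) F_word_Cons image_comp[symmetric] by blast
    have "x' \<in> SG" "y' \<in> SG" using x'(2) y'(2) by blast+
    then have "x' \<in> V m" "y' \<in> V m" using V_Suc_cell xy(1,2) unfolding x'(1) y'(1) by blast+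
    then have "adj m x' y'" unfolding adj_def using x' y' xy(3) v(2) by blast
    then show "z \<in> ?R" unfolding z x'(1) y'(1) by (intro UN_I[of i] image_eqI[of _ _ "(x', y')"]) auto
  qed
  show "?R \<subseteq> ?L"
  proof
    fix z assume "z \<in> ?R"
    then obtain i x y where "adj m x y" and z: "z = (F i x, F i y)" by auto
    then obtain w where w: "length w = m" "x \<in> F_word w ` SG" "y \<in> F_word w ` SG"
      and xy: "x \<in> V m" "y \<in> V m" "x \<noteq> y"
      unfolding adj_def by blast
    then have "F i x \<in> F_word (i # w) ` SG" "F i y \<in> F_word (i # w) ` SG" by auto
    moreover have "F i x \<in> V (Suc m)" "F i y \<in> V (Suc m)" using xy by (auto simp: V_Suc)
    ultimately have "adj (Suc m) (F i x) (F i y)"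
      unfolding adj_def using w(1) xy(3) by (intro conjI exI[of _ "i # w"]) auto
    then show "z \<in> ?L" unfolding z by simp
  qed
qed

subsection \<open>The energy\<close>

lemma offdiag_triple:
  assumes "a \<noteq> b" "b \<noteq> c" "a \<noteq> c"
  shows "{(x, y). x \<in> {a, b, c} \<and> y \<in> {a, b, c} \<and> x \<noteq> y}
    = {(a, b), (b, a), (b, c), (c, b), (a, c), (c, a)}"
  using assms by auto

lemma energy_level_0:
  "energy_level 0 u v = (u (q 0) - u (q 1)) * (v (q 0) - v (q 1))
     + (u (q 1) - u (q 2)) * (v (q 1) - v (q 2)) + (u (q 2) - u (q 0)) * (v (q 2) - v (q 0))"
proof -
  have ne: "q 0 \<noteq> q 1" "q 1 \<noteq> q 2" "q 0 \<noteq> q 2" using inj_q neq_3 by blast+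
  have "{(x, y). adj 0 x y} = {(q 0, q 1), (q 1, q 0), (q 1, q 2), (q 2, q 1), (q 0, q 2), (q 2, q 0)}"
    using offdiag_triple[OF ne] by (simp add: adj_0 V0_def UNIV_3_eq)
  then show ?thesis unfolding energy_level_def using ne by (simp add: algebra_simps)
qed

lemma energy_level_Suc:
  "energy_level (Suc m) u v = 5/3 * (\<Sum>i\<in>UNIV. energy_level m (u \<circ> F i) (v \<circ> F i))"
proof -
  let ?A = "\<lambda>i. map_prod (F i) (F i) ` {(x, y). adj m x y}"
  let ?g = "\<lambda>(x, y). (u x - u y) * (v x - v y)"
  have disj: "?A i \<inter> ?A j = {}" if "i \<noteq> j" for i j
  proof -
    \<comment> \<open>An edge has two distinct endpoints, while two distinct cells share only one
      point, so no edge is counted in two cells.\<close>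
    have no: False if "adj m x y" "adj m x' y'" "F i x = F j x'" "F i y = F j y'" for x y x' y'
    proof -
      have "x \<in> SG" "y \<in> SG" "x' \<in> SG" "y' \<in> SG" "x \<noteq> y"
        using that(1,2) by (auto dest: adj_SG)
      then show False using F_meet[OF \<open>i \<noteq> j\<close>] that(3,4) by metis
    qed
    show ?thesis
    proof (rule equals0I)
      fix z assume "z \<in> ?A i \<inter> ?A j"
      then have "z \<in> ?A i" "z \<in> ?A j" by (rule IntD1, rule IntD2)
      then obtain a b where "a \<in> {(x, y). adj m x y}" "z = map_prod (F i) (F i) a"
        "b \<in> {(x, y). adj m x y}" "z = map_prod (F j) (F j) b" by (elim imageE)
      then show False
        using no[of "fst a" "snd a" "fst b" "snd b"] by (simp add: case_prod_unfold map_prod_def)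
    qed
  qed
  have "sum ?g {(x, y). adj (Suc m) x y} = (\<Sum>i\<in>UNIV. sum ?g (?A i))"
    unfolding adj_Suc by (rule sum.UNION_disjoint) (use finite_adj disj in auto)
  also have "\<dots> = (\<Sum>i\<in>UNIV. \<Sum>(x, y)\<in>{(x, y). adj m x y}.
      ((u \<circ> F i) x - (u \<circ> F i) y) * ((v \<circ> F i) x - (v \<circ> F i) y))"
  proof (rule sum.cong[OF refl])
    fix i
    have "inj_on (map_prod (F i) (F i)) {(x, y). adj m x y}"
      by (rule inj_on_subset[OF prod.inj_map[OF inj_F inj_F] subset_UNIV])
    then show "sum ?g (?A i) = (\<Sum>(x, y)\<in>{(x, y). adj m x y}.
      ((u \<circ> F i) x - (u \<circ> F i) y) * ((v \<circ> F i) x - (v \<circ> F i) y))"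
      by (simp add: sum.reindex o_def case_prod_unfold)
  qed
  finally show ?thesis unfolding energy_level_def by (simp add: sum_distrib_left mult.assoc)
qed

lemma energy_level_cong:
  assumes "\<And>x. x \<in> SG \<Longrightarrow> u x = u' x" "\<And>x. x \<in> SG \<Longrightarrow> v x = v' x"
  shows "energy_level m u v = energy_level m u' v'"
proof -
  have "(\<Sum>(x, y)\<in>{(x, y). adj m x y}. (u x - u y) * (v x - v y)) =
      (\<Sum>(x, y)\<in>{(x, y). adj m x y}. (u' x - u' y) * (v' x - v' y))"
  proof (rule sum.cong[OF refl], clarify)
    fix x y assume "adj m x y"
    then have "x \<in> SG" "y \<in> SG" by (simp_all add: adj_SG)
    then show "(u x - u y) * (v x - v y) = (u' x - u' y) * (v' x - v' y)" by (simp add: assms)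
  qed
  then show ?thesis by (simp add: energy_level_def)
qed

lemma energy_level_commute: "energy_level m u v = energy_level m v u"
  unfolding energy_level_def by (simp add: mult.commute)

lemma energy_level_nonneg: "energy_level m u u \<ge> 0"
proof -
  have "0 \<le> (\<Sum>(x, y)\<in>{(x, y). adj m x y}. (u x - u y) * (u x - u y))"
    by (rule sum_nonneg) (simp add: case_prod_unfold)
  then show ?thesis unfolding energy_level_def by simp
qed

lemma energy_level_lincomb:
  "energy_level m (\<lambda>x. a * u x + b * v x) w = a * energy_level m u w + b * energy_level m v w"
proof -
  have "(\<Sum>(x, y)\<in>A. (a * u x + b * v x - (a * u y + b * v y)) * (w x - w y))
     = a * (\<Sum>(x, y)\<in>A. (u x - u y) * (w x - w y)) + b * (\<Sum>(x, y)\<in>A. (v x - v y) * (w x - w y))" for A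
    unfolding sum_distrib_left sum.distrib[symmetric]
    by (intro sum.cong refl) (auto simp: algebra_simps)
  then show ?thesis unfolding energy_level_def by (simp add: algebra_simps)
qed

lemma energy_level_lincomb_right:
  "energy_level m w (\<lambda>x. a * u x + b * v x) = a * energy_level m w u + b * energy_level m w v"
  using energy_level_lincomb energy_level_commute by simp

text \<open>The inequality is the minimality of the harmonic extension: in terms of the deviations
  \<open>d\<^sub>i\<close> of the midpoint values from the harmonic ones, the difference of the two sides is
  a positive semidefinite quadratic form.\<close>

lemma energy_level_mono_Suc: "energy_level m u u \<le> energy_level (Suc m) u u"
proof (induction m arbitrary: u)
  case 0
  have *: "(a - b)\<^sup>2 + (b - c)\<^sup>2 + (c - a)\<^sup>2 \<le> 5/3 * (
     ((a - z)\<^sup>2 + (z - y)\<^sup>2 + (y - a)\<^sup>2) + ((z - b)\<^sup>2 + (b - x)\<^sup>2 + (x - z)\<^sup>2) +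
     ((y - x)\<^sup>2 + (x - c)\<^sup>2 + (c - y)\<^sup>2))" for a b c x y z :: real
  proof -
    define d e f where d: "d = x - (a + 2 * b + 2 * c) / 5" and e: "e = y - (2 * a + b + 2 * c) / 5"
      and f: "f = z - (2 * a + 2 * b + c) / 5"
    have "5/3 * (
     ((a - z)\<^sup>2 + (z - y)\<^sup>2 + (y - a)\<^sup>2) + ((z - b)\<^sup>2 + (b - x)\<^sup>2 + (x - z)\<^sup>2) +
     ((y - x)\<^sup>2 + (x - c)\<^sup>2 + (c - y)\<^sup>2)) = (a - b)\<^sup>2 + (b - c)\<^sup>2 + (c - a)\<^sup>2
      + 5/3 * (2 * d\<^sup>2 + 2 * e\<^sup>2 + 2 * f\<^sup>2 + (d - e)\<^sup>2 + (e - f)\<^sup>2 + (f - d)\<^sup>2)"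
      unfolding d e f by (simp add: power2_eq_square field_simps)
    then show ?thesis by simp
  qed
  show ?case
    unfolding energy_level_Suc energy_level_0 sum_UNIV_3 o_def F_q_self
      F_q_commute[of 1 0] F_q_commute[of 2 0] F_q_commute[of 2 1]
    by (rule *[unfolded power2_eq_square])
next
  case (Suc m)
  show ?case
    unfolding energy_level_Suc[of m u u] energy_level_Suc[of "Suc m" u u]
    by (rule mult_left_mono[OF sum_mono[OF Suc]]) simp
qed

lemma energy_level_incseq: "incseq (\<lambda>m. energy_level m u u)"
  by (rule incseq_SucI) (rule energy_level_mono_Suc)

text \<open>The levels increase, so a uniform bound already yields convergence and no limit has to
  be identified.\<close>

lemma dom_energyI:
  assumes "continuous_on SG u" "\<And>m. energy_level m u u \<le> C"
  shows "u \<in> dom_energy"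
proof -
  obtain L where "(\<lambda>m. energy_level m u u) \<longlonglongrightarrow> L"
    using incseq_convergent[OF energy_level_incseq[of u], of C] assms(2) by blast
  then show ?thesis using assms(1) by (auto simp: dom_energy_def convergent_def)
qed

lemma dom_energy_bounded:
  assumes "u \<in> dom_energy"
  obtains C where "\<And>m. energy_level m u u \<le> C"
  using assms incseq_le[OF energy_level_incseq[of u]] unfolding dom_energy_def convergent_def by blast

lemma dom_energy_lincomb:
  assumes "u \<in> dom_energy" "v \<in> dom_energy"
  shows "(\<lambda>x. a * u x + b * v x) \<in> dom_energy"
proof -
  obtain C where C: "\<And>m. energy_level m u u \<le> C" using dom_energy_bounded assms(1) by blast
  obtain D where D: "\<And>m. energy_level m v v \<le> D" using dom_energy_bounded assms(2) by blast
  have "energy_level m (\<lambda>x. a * u x + b * v x) (\<lambda>x. a * u x + b * v x) \<le> 2 * a\<^sup>2 * C + 2 * b\<^sup>2 * D" for m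
  proof -
    \<comment> \<open>Nonnegativity for the difference bounds the cross term, as in the
      parallelogram law.\<close>
    have "0 \<le> energy_level m (\<lambda>x. a * u x + (- b) * v x) (\<lambda>x. a * u x + (- b) * v x)"
      by (rule energy_level_nonneg)
    then have "energy_level m (\<lambda>x. a * u x + b * v x) (\<lambda>x. a * u x + b * v x)
      \<le> 2 * a\<^sup>2 * energy_level m u u + 2 * b\<^sup>2 * energy_level m v v"
      unfolding energy_level_lincomb energy_level_lincomb_right
      by (simp add: power2_eq_square algebra_simps)
    also have "\<dots> \<le> 2 * a\<^sup>2 * C + 2 * b\<^sup>2 * D"
      by (intro add_mono mult_left_mono C D) auto
    finally show ?thesis .
  qed
  then show ?thesis
    using assms by (intro dom_energyI) (auto simp: dom_energy_def intro!: continuous_intros)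
qed

text \<open>Polarisation: \<open>dom_energy\<close> speaks of the diagonal only, so the convergence
  that gives the \<open>lim\<close> in \<open>energy\<close> its meaning is read off from
  \<open>u + v\<close>, \<open>u\<close> and \<open>v\<close>.\<close>

lemma energy_level_tendsto:
  assumes "u \<in> dom_energy" "v \<in> dom_energy"
  shows "(\<lambda>m. energy_level m u v) \<longlonglongrightarrow> energy u v"
proof -
  have *: "(\<lambda>x. 1 * u x + 1 * v x) \<in> dom_energy" by (rule dom_energy_lincomb[OF assms])
  have "energy_level m u v = (energy_level m (\<lambda>x. 1 * u x + 1 * v x) (\<lambda>x. 1 * u x + 1 * v x)
      - energy_level m u u - energy_level m v v) * (1 / 2)" for m
    unfolding energy_level_lincomb energy_level_lincomb_right
    by (simp add: energy_level_commute[of m v u])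
  then have "(\<lambda>m. energy_level m u v) = (\<lambda>m. (energy_level m (\<lambda>x. 1 * u x + 1 * v x)
      (\<lambda>x. 1 * u x + 1 * v x) - energy_level m u u - energy_level m v v) * (1 / 2))"
    by (rule ext)
  moreover have "convergent (\<lambda>m. (energy_level m (\<lambda>x. 1 * u x + 1 * v x) (\<lambda>x. 1 * u x + 1 * v x)
      - energy_level m u u - energy_level m v v) * (1 / 2))"
    using * assms unfolding dom_energy_def
    by (intro convergent_mult convergent_diff convergent_const) auto
  ultimately have "convergent (\<lambda>m. energy_level m u v)" by (simp only:)
  then show ?thesis unfolding energy_def by (simp add: convergent_LIMSEQ_iff)
qed

lemma energy_eqI:
  assumes "(\<lambda>m. energy_level m u v) \<longlonglongrightarrow> e"
  shows "energy u v = e"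
  using assms unfolding energy_def by (rule limI)

lemma energy_cong:
  assumes "\<And>x. x \<in> SG \<Longrightarrow> u x = u' x" "\<And>x. x \<in> SG \<Longrightarrow> v x = v' x"
  shows "energy u v = energy u' v'"
  unfolding energy_def using energy_level_cong[of u u' v v'] assms by simp

lemma dom_energy_cong:
  assumes "\<And>x. x \<in> SG \<Longrightarrow> u x = u' x"
  shows "u \<in> dom_energy \<longleftrightarrow> u' \<in> dom_energy"
proof -
  have "continuous_on SG u \<longleftrightarrow> continuous_on SG u'" by (rule continuous_on_cong) (use assms in auto)
  moreover have "energy_level m u u = energy_level m u' u'" for m
    by (rule energy_level_cong) (use assms in auto)
  ultimately show ?thesis unfolding dom_energy_def by simp
qed

lemma energy_lincomb:
  assumes "u \<in> dom_energy" "v \<in> dom_energy" "w \<in> dom_energy"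
  shows "energy (\<lambda>x. a * u x + b * v x) w = a * energy u w + b * energy v w"
  by (rule energy_eqI, unfold energy_level_lincomb)
    (intro tendsto_intros energy_level_tendsto assms)

lemma continuous_on_comp_F:
  assumes "continuous_on SG u"
  shows "continuous_on SG (u \<circ> F i)"
  using assms by (intro continuous_on_compose continuous_on_F) (auto intro: continuous_on_subset)

lemma dom_energy_comp_F:
  assumes "u \<in> dom_energy"
  shows "u \<circ> F i \<in> dom_energy"
proof -
  obtain C where C: "\<And>m. energy_level m u u \<le> C" using dom_energy_bounded assms by blast
  show ?thesis
  proof (rule dom_energyI)
    show "continuous_on SG (u \<circ> F i)"
      using assms by (intro continuous_on_comp_F) (simp add: dom_energy_def)
    fix m
    have "energy_level m (u \<circ> F i) (u \<circ> F i) \<le> (\<Sum>i\<in>UNIV. energy_level m (u \<circ> F i) (u \<circ> F i))"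
      by (rule member_le_sum) (auto intro: energy_level_nonneg)
    also have "\<dots> = 3/5 * energy_level (Suc m) u u" by (simp add: energy_level_Suc)
    also have "\<dots> \<le> 3/5 * C" using C[of "Suc m"] by simp
    finally show "energy_level m (u \<circ> F i) (u \<circ> F i) \<le> 3/5 * C" .
  qed
qed

lemma energy_comp_F:
  assumes "u \<in> dom_energy" "v \<in> dom_energy"
  shows "energy u v = 5/3 * (\<Sum>i\<in>UNIV. energy (u \<circ> F i) (v \<circ> F i))"
proof -
  have "(\<lambda>m. energy_level (Suc m) u v) \<longlonglongrightarrow> 5/3 * (\<Sum>i\<in>UNIV. energy (u \<circ> F i) (v \<circ> F i))"
    unfolding energy_level_Suc
    by (intro tendsto_intros energy_level_tendsto dom_energy_comp_F assms)
  then show ?thesis by (rule energy_eqI[OF LIMSEQ_imp_Suc])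
qed

text \<open>Leibniz rule on each edge together with bounds for both factors. It serves to put the
  product \<open>bump\<close> into the energy domain.\<close>

lemma dom_energy_mult:
  assumes "u \<in> dom_energy" "v \<in> dom_energy"
  shows "(\<lambda>x. u x * v x) \<in> dom_energy"
proof -
  have cu: "continuous_on SG u" and cv: "continuous_on SG v" using assms by (auto simp: dom_energy_def)
  obtain A where A: "\<And>x. x \<in> SG \<Longrightarrow> \<bar>u x\<bar> \<le> A"
    using compact_imp_bounded[OF compact_continuous_image[OF cu SG_compact]]
    by (auto simp: bounded_iff)
  obtain B where B: "\<And>x. x \<in> SG \<Longrightarrow> \<bar>v x\<bar> \<le> B"
    using compact_imp_bounded[OF compact_continuous_image[OF cv SG_compact]]
    by (auto simp: bounded_iff)
  obtain C where C: "\<And>m. energy_level m u u \<le> C" using dom_energy_bounded assms(1) by blast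
  obtain D where D: "\<And>m. energy_level m v v \<le> D" using dom_energy_bounded assms(2) by blast
  have "energy_level m (\<lambda>x. u x * v x) (\<lambda>x. u x * v x) \<le> 2 * B\<^sup>2 * C + 2 * A\<^sup>2 * D" for m
  proof -
    have pt: "(u x * v x - u y * v y) * (u x * v x - u y * v y)
      \<le> 2 * B\<^sup>2 * ((u x - u y) * (u x - u y)) + 2 * A\<^sup>2 * ((v x - v y) * (v x - v y))"
      if "x \<in> SG" "y \<in> SG" for x y
    proof -
      have "(u x * v x - u y * v y)\<^sup>2 = ((u x - u y) * v x + u y * (v x - v y))\<^sup>2"
        by (simp add: algebra_simps)
      also have "\<dots> \<le> 2 * ((u x - u y) * v x)\<^sup>2 + 2 * (u y * (v x - v y))\<^sup>2"
        using zero_le_power2[of "(u x - u y) * v x - u y * (v x - v y)"]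
        by (simp add: power2_eq_square algebra_simps)
      also have "\<dots> = 2 * (v x)\<^sup>2 * (u x - u y)\<^sup>2 + 2 * (u y)\<^sup>2 * (v x - v y)\<^sup>2"
        by (simp add: power_mult_distrib)
      also have "\<dots> \<le> 2 * B\<^sup>2 * (u x - u y)\<^sup>2 + 2 * A\<^sup>2 * (v x - v y)\<^sup>2"
        using A[OF that(2)] B[OF that(1)]
        by (intro add_mono mult_right_mono mult_left_mono) (auto simp: abs_le_square_iff[symmetric])
      finally show ?thesis by (simp add: power2_eq_square)
    qed
    have "energy_level m (\<lambda>x. u x * v x) (\<lambda>x. u x * v x)
      \<le> (5/3)^m * (1/2 * (\<Sum>(x, y)\<in>{(x, y). adj m x y}.
        2 * B\<^sup>2 * ((u x - u y) * (u x - u y)) + 2 * A\<^sup>2 * ((v x - v y) * (v x - v y))))"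
      unfolding energy_level_def
    proof (intro mult_left_mono sum_mono, clarify)
      fix x y assume "adj m x y"
      then show "(u x * v x - u y * v y) * (u x * v x - u y * v y)
        \<le> 2 * B\<^sup>2 * ((u x - u y) * (u x - u y)) + 2 * A\<^sup>2 * ((v x - v y) * (v x - v y))"
        using pt adj_SG by blast
    qed auto
    also have "\<dots> = 2 * B\<^sup>2 * energy_level m u u + 2 * A\<^sup>2 * energy_level m v v"
      unfolding energy_level_def case_prod_unfold sum.distrib sum_distrib_left[symmetric]
      by (simp add: algebra_simps)
    also have "\<dots> \<le> 2 * B\<^sup>2 * C + 2 * A\<^sup>2 * D"
      by (intro add_mono mult_left_mono C D) auto
    finally show ?thesis .
  qed
  then show ?thesis by (intro dom_energyI continuous_on_mult cu cv)
qed


subsection \<open>Gluing functions along cells\<close>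

definition F_inv :: "3 \<Rightarrow> point \<Rightarrow> point" where
  "F_inv i x = 2 *\<^sub>R x - q i"

lemma F_inv_F [simp]: "F_inv i (F i x) = x"
  by (simp add: F_inv_def F_def algebra_simps flip: scaleR_2)

text \<open>On cell \<open>i\<close> this is the piece \<open>g i\<close> transported there. A
  junction point lies in two cells and \<open>SOME\<close> may pick either; the compatibility
  \<open>g i (q j) = g j (q i)\<close> makes the choice irrelevant, because
  \<open>F i (q j) = F j (q i)\<close>.\<close>

definition glue :: "(3 \<Rightarrow> point \<Rightarrow> real) \<Rightarrow> point \<Rightarrow> real" where
  "glue g x = (let i = SOME i. x \<in> F i ` SG in g i (F_inv i x))"

lemma glue_F:
  assumes g: "\<And>i j. g i (q j) = g j (q i)" and x: "x \<in> SG"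
  shows "glue g (F i x) = g i x"
proof -
  define k where "k = (SOME k. F i x \<in> F k ` SG)"
  have "F i x \<in> F k ` SG"
    unfolding k_def by (rule someI[of _ i]) (use x in blast)
  then obtain y where y: "y \<in> SG" "F i x = F k y" by blast
  have "glue g (F i x) = g k (F_inv k (F i x))"
    by (simp add: glue_def Let_def k_def)
  also have "\<dots> = g k y" by (simp add: y(2))
  also have "\<dots> = g i x"
    using F_meet[OF _ x y] g y by (cases "i = k") auto
  finally show ?thesis .
qed

lemma continuous_on_glue:
  assumes g: "\<And>i j. g i (q j) = g j (q i)" and cont: "\<And>i. continuous_on SG (g i)"
  shows "continuous_on SG (glue g)"
proof -
  have "continuous_on (F i ` SG) (glue g)" for i
  proof -
    have "continuous_on (F i ` SG) (F_inv i)"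
      unfolding F_inv_def[abs_def] by (intro continuous_intros)
    moreover have "F_inv i ` F i ` SG = SG" by (simp add: image_image)
    ultimately have "continuous_on (F i ` SG) (g i \<circ> F_inv i)"
      using cont[of i] by (intro continuous_on_compose) simp_all
    then show ?thesis
      by (rule continuous_on_cong[THEN iffD1, rotated 2]) (use glue_F[of g, OF g] in auto)
  qed
  moreover have "closed (F i ` SG)" for i
    by (intro compact_imp_closed compact_continuous_image continuous_on_F SG_compact)
  ultimately have "continuous_on (\<Union>i. F i ` SG) (glue g)"
    by (intro continuous_on_closed_Union) auto
  then show ?thesis using SG_eq by simp
qed

lemma glue_dom_energy:
  assumes g: "\<And>i j. g i (q j) = g j (q i)" and dom: "\<And>i. g i \<in> dom_energy"
  shows "glue g \<in> dom_energy"
proof -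
  have "\<exists>C. \<forall>m. energy_level m (g i) (g i) \<le> C" for i
    using dom_energy_bounded[OF dom[of i]] by blast
  then obtain C where C: "\<And>i m. energy_level m (g i) (g i) \<le> C i"
    by metis
  have "energy_level m (glue g) (glue g) \<le> 5/3 * (\<Sum>i\<in>UNIV. C i)" for m
  proof -
    \<comment> \<open>Passing to the next level makes the self-similar formula applicable for every
      \<open>m\<close>, including 0.\<close>
    have "energy_level m (glue g) (glue g) \<le> energy_level (Suc m) (glue g) (glue g)"
      by (rule energy_level_mono_Suc)
    also have "\<dots> = 5/3 * (\<Sum>i\<in>UNIV. energy_level m (glue g \<circ> F i) (glue g \<circ> F i))"
      by (rule energy_level_Suc)
    also have "\<dots> = 5/3 * (\<Sum>i\<in>UNIV. energy_level m (g i) (g i))"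
      using glue_F[of g, OF g] by (simp add: energy_level_cong[of "glue g \<circ> F _" "g _"])
    also have "\<dots> \<le> 5/3 * (\<Sum>i\<in>UNIV. C i)"
      by (intro mult_left_mono sum_mono C) simp
    finally show ?thesis .
  qed
  moreover have "continuous_on SG (glue g)"
    using dom by (intro continuous_on_glue g) (simp add: dom_energy_def)
  ultimately show ?thesis by (rule dom_energyI[rotated])
qed

subsection \<open>Harmonic functions\<close>

text \<open>The 1/5--2/5 rule: \<open>harmonic_step i a j\<close> is the value at \<open>F i (q j)\<close> of the harmonic
  function with boundary values \<open>a\<close>.\<close>

definition harmonic_step :: "3 \<Rightarrow> (3 \<Rightarrow> real) \<Rightarrow> 3 \<Rightarrow> real" where
  "harmonic_step i a j = (if i = j then a i else (a i + a j + (a 0 + a 1 + a 2)) / 5)"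

lemma harmonic_step_commute: "harmonic_step i a j = harmonic_step j a i"
  by (auto simp: harmonic_step_def)

text \<open>The subdivision rule is applied down to level \<open>m\<close>, followed by linear
  interpolation on each \<open>m\<close>-cell. This gives a continuous function on all of
  \<open>SG\<close> at each stage, not just values on vertices.\<close>

fun harmonic_approx :: "nat \<Rightarrow> (3 \<Rightarrow> real) \<Rightarrow> point \<Rightarrow> real" where
  "harmonic_approx 0 a = (\<lambda>x. \<Sum>i\<in>UNIV. a i * bary i x)"
| "harmonic_approx (Suc m) a = glue (\<lambda>i. harmonic_approx m (harmonic_step i a))"

lemma harmonic_approx_q: "harmonic_approx m a (q j) = a j"
proof (induction m arbitrary: a j)
  case 0
  then show ?case using exhaust_3_cases[of j] by (auto simp: sum_UNIV_3 bary_q)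
next
  case (Suc m)
  have "harmonic_approx (Suc m) a (F j (q j)) = harmonic_step j a j"
    unfolding harmonic_approx.simps by (subst glue_F) (auto simp: Suc harmonic_step_commute)
  then show ?case by (simp add: harmonic_step_def)
qed

lemma harmonic_approx_F:
  assumes "x \<in> SG"
  shows "harmonic_approx (Suc m) a (F i x) = harmonic_approx m (harmonic_step i a) x"
  unfolding harmonic_approx.simps
  by (rule glue_F[OF _ assms]) (simp add: harmonic_approx_q harmonic_step_commute)

lemma continuous_on_harmonic_approx: "continuous_on SG (harmonic_approx m a)"
proof (induction m arbitrary: a)
  case 0
  then show ?case by (auto intro!: continuous_intros continuous_on_bary)
next
  case (Suc m)
  then show ?case unfolding harmonic_approx.simps
    by (intro continuous_on_glue) (simp_all add: harmonic_approx_q harmonic_step_commute)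
qed

lemma harmonic_step_le:
  assumes "\<And>i. a i \<le> hi"
  shows "harmonic_step i a j \<le> hi"
  using assms[of i] assms[of j] assms[of 0] assms[of 1] assms[of 2]
  by (auto simp: harmonic_step_def)

lemma harmonic_approx_le:
  assumes "\<And>i. a i \<le> hi" "x \<in> SG"
  shows "harmonic_approx m a x \<le> hi"
  using assms
proof (induction m arbitrary: a x)
  case 0
  have "(\<Sum>i\<in>UNIV. a i * bary i x) \<le> (\<Sum>i\<in>UNIV. hi * bary i x)"
    by (intro sum_mono mult_right_mono 0 bary_nonneg)
  also have "\<dots> = hi" using bary_sum[of x] by (simp add: sum_UNIV_3 flip: distrib_left)
  finally show ?case by simp
next
  case (Suc m)
  obtain i y where y: "y \<in> SG" "x = F i y" using Suc.prems(2) by (rule SG_cases)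
  show ?case unfolding y(2) harmonic_approx_F[OF y(1)]
    by (intro Suc.IH harmonic_step_le Suc.prems y)
qed

text \<open>The extreme case compares the fixed corner \<open>k\<close> with another corner
  \<open>j\<close>: with \<open>l\<close> the third one, the difference is
  \<open>(3 * a k - 2 * a j - a l) / 5\<close>, at most \<open>(2 + 1) / 5\<close> of
  \<open>d\<close>. Between the two other corners the factor is only 1/5.\<close>

lemma harmonic_step_diff_le:
  assumes "\<And>i j. a i - a j \<le> d"
  shows "harmonic_step k a i - harmonic_step k a j \<le> 3/5 * d"
  using assms[of 0 1] assms[of 0 2] assms[of 1 0] assms[of 1 2] assms[of 2 0] assms[of 2 1]
    exhaust_3_cases[of i] exhaust_3_cases[of j] exhaust_3_cases[of k] assms[of 0 0]
  by (auto simp: harmonic_step_def add_divide_distrib)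

lemma harmonic_approx_minus: "x \<in> SG \<Longrightarrow> harmonic_approx m (\<lambda>i. - a i) x = - harmonic_approx m a x"
proof (induction m arbitrary: a x)
  case (Suc m)
  obtain i y where y: "y \<in> SG" "x = F i y" using Suc.prems by (rule SG_cases)
  have "harmonic_step i (\<lambda>i. - a i) = (\<lambda>j. - harmonic_step i a j)"
    by (auto simp: fun_eq_iff harmonic_step_def field_simps)
  then show ?case unfolding y(2) harmonic_approx_F[OF y(1)] by (simp add: Suc.IH[OF y(1)])
qed (simp add: sum_negf)

lemma harmonic_approx_ge:
  assumes "\<And>i. lo \<le> a i" "x \<in> SG"
  shows "lo \<le> harmonic_approx m a x"
  using harmonic_approx_le[of "\<lambda>i. - a i" "- lo" x m] assms by (simp add: harmonic_approx_minus)

text \<open>On an \<open>m\<close>-cell both approximations stay between the extreme corner values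
  there, and these differ by at most \<open>(3/5) ^ m * d\<close>.\<close>

lemma harmonic_approx_diff:
  assumes "\<And>i j. a i - a j \<le> d" "x \<in> SG"
  shows "\<bar>harmonic_approx (Suc m) a x - harmonic_approx m a x\<bar> \<le> (3/5) ^ m * d"
  using assms
proof (induction m arbitrary: a x d)
  case 0
  define hi lo where "hi = Max (range a)" and "lo = Min (range a)"
  have hi: "a i \<le> hi" and lo: "lo \<le> a i" for i by (simp_all add: hi_def lo_def)
  have "hi \<in> range a" "lo \<in> range a" unfolding hi_def lo_def by (auto intro!: Max_in Min_in)
  then have "hi - lo \<le> d" using 0(1) by blast
  then show ?case
    using harmonic_approx_le[of a hi x 0, OF hi 0(2)] harmonic_approx_le[of a hi x 1, OF hi 0(2)]
      harmonic_approx_ge[of lo a x 0, OF lo 0(2)] harmonic_approx_ge[of lo a x 1, OF lo 0(2)]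
    by simp
next
  case (Suc m)
  obtain i y where y: "y \<in> SG" "x = F i y" using Suc.prems(2) by (rule SG_cases)
  show ?case unfolding y(2) harmonic_approx_F[OF y(1)]
    using Suc.IH[of "harmonic_step i a" "3/5 * d" y, OF harmonic_step_diff_le y(1)] Suc.prems(1)
    by (simp add: mult_ac)
qed

text \<open>The limit of the approximations, written as a telescoping series so that the Weierstrass
  M-test yields uniform convergence and hence continuity.\<close>

definition harmonic :: "(3 \<Rightarrow> real) \<Rightarrow> point \<Rightarrow> real" where
  "harmonic a x = harmonic_approx 0 a x
     + (\<Sum>m. harmonic_approx (Suc m) a x - harmonic_approx m a x)"

lemma harmonic_uniform_limit:
  "uniform_limit SG (\<lambda>m. harmonic_approx m a) (harmonic a) sequentially"
proof -
  define d where "d = Max (range a) - Min (range a)"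
  have d: "a i - a j \<le> d" for i j
    unfolding d_def by (intro diff_mono Max_ge Min_le) auto
  have "summable (\<lambda>m. (3/5) ^ m * d :: real)"
    by (intro summable_mult2 summable_geometric) simp
  then have "uniform_limit SG (\<lambda>m x. \<Sum>k<m. harmonic_approx (Suc k) a x - harmonic_approx k a x)
      (\<lambda>x. \<Sum>k. harmonic_approx (Suc k) a x - harmonic_approx k a x) sequentially"
    using harmonic_approx_diff[of a d, OF d] by (intro Weierstrass_m_test) auto
  then have "uniform_limit SG (\<lambda>m x. harmonic_approx 0 a x
        + (\<Sum>k<m. harmonic_approx (Suc k) a x - harmonic_approx k a x))
      (\<lambda>x. harmonic_approx 0 a x + (\<Sum>k. harmonic_approx (Suc k) a x - harmonic_approx k a x)) sequentially"
    by (intro uniform_limit_add uniform_limit_const)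
  moreover have "harmonic_approx 0 a x
      + (\<Sum>k<m. harmonic_approx (Suc k) a x - harmonic_approx k a x) = harmonic_approx m a x" for m x
    using sum_lessThan_telescope[of "\<lambda>k. harmonic_approx k a x" m]
    by (simp del: harmonic_approx.simps)
  ultimately show ?thesis
    unfolding harmonic_def[abs_def] by (simp only:)
qed

lemma harmonic_tendsto: "x \<in> SG \<Longrightarrow> (\<lambda>m. harmonic_approx m a x) \<longlonglongrightarrow> harmonic a x"
  using tendsto_uniform_limitI[OF harmonic_uniform_limit] .

lemma continuous_on_harmonic: "continuous_on SG (harmonic a)"
  by (rule uniform_limit_theorem[OF _ harmonic_uniform_limit])
    (auto intro: always_eventually continuous_on_harmonic_approx)

lemma harmonic_F:
  assumes "x \<in> SG"
  shows "harmonic a (F i x) = harmonic (harmonic_step i a) x"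
proof (rule LIMSEQ_unique)
  show "(\<lambda>m. harmonic_approx (Suc m) a (F i x)) \<longlonglongrightarrow> harmonic a (F i x)"
    using harmonic_tendsto[OF F_in_SG[OF assms]] by (rule LIMSEQ_Suc)
  show "(\<lambda>m. harmonic_approx (Suc m) a (F i x)) \<longlonglongrightarrow> harmonic (harmonic_step i a) x"
    unfolding harmonic_approx_F[OF assms] by (rule harmonic_tendsto[OF assms])
qed

lemma harmonic_q [simp]: "harmonic a (q i) = a i"
  using harmonic_tendsto[OF q_in_SG] by (simp add: harmonic_approx_q LIMSEQ_const_iff)

lemma harmonic_le:
  assumes "\<And>i. a i \<le> hi" "x \<in> SG"
  shows "harmonic a x \<le> hi"
  by (rule LIMSEQ_le_const2[OF harmonic_tendsto[OF assms(2)]])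
    (use harmonic_approx_le[of a hi] assms in blast)

lemma harmonic_ge:
  assumes "\<And>i. lo \<le> a i" "x \<in> SG"
  shows "lo \<le> harmonic a x"
  by (rule LIMSEQ_le_const[OF harmonic_tendsto[OF assms(2)]])
    (use harmonic_approx_ge[of lo a] assms in blast)

text \<open>A discrete Gauss-Green formula: against a harmonic function the values of
  \<open>u\<close> at the new vertices cancel, so only boundary values remain, independently of
  \<open>m\<close>. This gives finite energy and, for \<open>u\<close> vanishing on
  \<open>V0\<close>, Laplacian 0.\<close>

lemma energy_level_harmonic:
  "energy_level m u (harmonic a) = (u (q 0) - u (q 1)) * (a 0 - a 1)
     + (u (q 1) - u (q 2)) * (a 1 - a 2) + (u (q 2) - u (q 0)) * (a 2 - a 0)"
proof (induction m arbitrary: u a)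
  case 0
  then show ?case by (simp add: energy_level_0)
next
  case (Suc m)
  have "energy_level m (u \<circ> F i) (harmonic a \<circ> F i)
    = energy_level m (u \<circ> F i) (harmonic (harmonic_step i a))" for i
    by (rule energy_level_cong) (simp_all add: harmonic_F)
  note step = trans[OF this Suc.IH]
  show ?case
    unfolding energy_level_Suc[of m u] step
    by (simp add: sum_UNIV_3 harmonic_step_def F_q_commute[of 1 0] F_q_commute[of 2 0] F_q_commute[of 2 1] field_simps)
qed

lemma harmonic_dom_energy: "harmonic a \<in> dom_energy"
  by (rule dom_energyI[OF continuous_on_harmonic]) (rule order.refl[THEN ord_eq_le_trans[OF energy_level_harmonic]])

lemma has_laplacian_harmonic: "has_laplacian M (harmonic a) (\<lambda>x. 0)"
proof -
  have "energy (harmonic a) v = 0" if "\<forall>x\<in>V0. v x = 0" for v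
    by (rule energy_eqI)
      (use that in \<open>simp add: energy_level_commute[of _ "harmonic a"] energy_level_harmonic\<close>)
  then show ?thesis by (simp add: has_laplacian_def harmonic_dom_energy)
qed

text \<open>At each point of \<open>V0\<close> one of the factors vanishes, so this is an admissible test function.\<close>

definition bump :: "point \<Rightarrow> real" where
  "bump x = harmonic (\<lambda>i. of_bool (i = 0)) x * harmonic (\<lambda>i. of_bool (i = 1)) x"

lemma bump_dom_energy: "bump \<in> dom_energy"
  unfolding bump_def[abs_def] by (intro dom_energy_mult harmonic_dom_energy)

lemma bump_q [simp]: "bump (q i) = 0"
  by (simp add: bump_def)

lemma bump_nonneg: "x \<in> SG \<Longrightarrow> bump x \<ge> 0"
  unfolding bump_def by (intro mult_nonneg_nonneg harmonic_ge) auto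

text \<open>On cell 0 the corner values are 1, 2/5, 2/5 for the first factor and 0, 2/5, 1/5 for the
  second. As the second vanishes at \<open>q 0\<close>, one more subdivision is made: on subcell 1
  it is at least 1/5. The bound is the product of 2/5 and 1/5.\<close>

lemma bump_ge:
  assumes "x \<in> SG"
  shows "bump (F 0 (F 1 x)) \<ge> 2/25"
proof -
  have "2/5 \<le> harmonic (\<lambda>i. of_bool (i = 0)) (F 0 (F 1 x))"
    unfolding harmonic_F[OF F_in_SG[OF assms]]
    by (rule harmonic_ge) (use assms in \<open>auto simp: harmonic_step_def\<close>)
  moreover have "1/5 \<le> harmonic (\<lambda>i. of_bool (i = 1)) (F 0 (F 1 x))"
    unfolding harmonic_F[OF F_in_SG[OF assms]] harmonic_F[OF assms]
    by (rule harmonic_ge) (use assms in \<open>auto simp: harmonic_step_def\<close>)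
  ultimately have "2/5 * (1/5) \<le> bump (F 0 (F 1 x))" unfolding bump_def by (intro mult_mono) auto
  then show ?thesis by simp
qed


subsection \<open>Cells and the reflection\<close>

lemma dist_F_word: "dist (F_word w x) (F_word w y) = dist x y / 2 ^ length w"
  by (induction w) (simp_all add: dist_F)

lemma SG_cell:
  assumes "x \<in> SG"
  obtains w y where "length w = m" "y \<in> SG" "x = F_word w y"
proof -
  have "\<exists>w y. length w = m \<and> y \<in> SG \<and> x = F_word w y"
    using assms
  proof (induction m arbitrary: x)
    case (Suc m)
    obtain i y where y: "y \<in> SG" "x = F i y" using Suc.prems by (rule SG_cases)
    obtain w z where "length w = m" "z \<in> SG" "y = F_word w z" using Suc.IH[OF y(1)] by blast
    then show ?case using y(2) by (intro exI[of _ "i # w"] exI[of _ z]) simp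
  next
    case 0
    then show ?case by (intro exI[of _ "[]"] exI[of _ x]) simp
  qed
  then show ?thesis using that by blast
qed

text \<open>Uniform continuity in terms of words: an \<open>m\<close>-cell has diameter at most that
  of \<open>SG\<close> divided by \<open>2 ^ m\<close>.\<close>

lemma cell_oscillation:
  fixes f :: "point \<Rightarrow> real"
  assumes "continuous_on SG f" "e > 0"
  obtains m where "\<And>w x y. length w = m \<Longrightarrow> x \<in> SG \<Longrightarrow> y \<in> SG \<Longrightarrow> \<bar>f (F_word w x) - f (F_word w y)\<bar> < e"
proof -
  have "uniformly_continuous_on SG f"
    by (rule compact_uniformly_continuous[OF assms(1) SG_compact])
  then obtain d where d: "d > 0" "\<And>x y. x \<in> SG \<Longrightarrow> y \<in> SG \<Longrightarrow> dist y x < d \<Longrightarrow> dist (f y) (f x) < e"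
    using assms(2) unfolding uniformly_continuous_on_def by metis
  obtain b where b: "\<And>x y. x \<in> SG \<Longrightarrow> y \<in> SG \<Longrightarrow> dist x y \<le> b"
    using compact_imp_bounded[OF SG_compact] unfolding bounded_two_points by blast
  obtain m where "b / d < 2 ^ m" using real_arch_pow[of 2 "b / d"] by auto
  then have m: "b / 2 ^ m < d" using d(1) by (simp add: field_simps)
  have "\<bar>f (F_word w x) - f (F_word w y)\<bar> < e" if "length w = m" "x \<in> SG" "y \<in> SG" for w x y
  proof -
    have "dist (F_word w x) (F_word w y) \<le> b / 2 ^ m"
      unfolding dist_F_word that(1) by (intro divide_right_mono b that) simp
    then have "dist (F_word w x) (F_word w y) < d" using m by simp
    then show ?thesis using d(2)[of "F_word w y" "F_word w x"] that by (simp add: dist_real_def)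
  qed
  then show ?thesis using that by blast
qed

section \<open>The reflection fixing the top vertex\<close>

text \<open>Reflection in the vertical axis of the triangle. It swaps the two lower vertices and so
  acts on indices as negation modulo 3.\<close>

definition refl_SG :: "point \<Rightarrow> point" where
  "refl_SG x = (1 - fst x, snd x)"

lemma refl_SG_invol [simp]: "refl_SG (refl_SG x) = x"
  by (simp add: refl_SG_def)

lemma bary_refl_SG: "bary k (refl_SG x) = bary (- k) x"
  using exhaust_3_cases[of k] by (auto simp: bary_def refl_SG_def minus_3)

lemma refl_SG_F: "refl_SG (F i x) = F (- i) (refl_SG x)"
proof (rule bary_inject)
  fix k
  have "- k = i \<longleftrightarrow> k = - i" by (metis minus_minus)
  then show "bary k (refl_SG (F i x)) = bary k (F (- i) (refl_SG x))"
    by (simp add: bary_F bary_refl_SG)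
qed

lemma refl_SG_q [simp]: "refl_SG (q i) = q (- i)"
proof (rule bary_inject)
  fix k
  have "- k = i \<longleftrightarrow> k = - i" by (metis minus_minus)
  then show "bary k (refl_SG (q i)) = bary k (q (- i))" by (simp add: bary_q bary_refl_SG)
qed

lemma continuous_on_refl_SG: "continuous_on A refl_SG"
  unfolding refl_SG_def[abs_def] by (intro continuous_intros)

lemma refl_SG_image: "refl_SG ` SG = SG"
proof (rule SG_unique)
  show "compact (refl_SG ` SG)"
    by (intro compact_continuous_image continuous_on_refl_SG SG_compact)
  have "refl_SG ` SG = refl_SG ` (\<Union>i. F i ` SG)" using SG_eq by simp
  also have "\<dots> = (\<Union>i. F (- i) ` refl_SG ` SG)" by (simp add: image_UN image_image refl_SG_F)
  also have "\<dots> = (\<Union>i. F i ` refl_SG ` SG)" by (simp add: UNIV_3_eq minus_3 Un_ac)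
  finally show "refl_SG ` SG = (\<Union>i. F i ` refl_SG ` SG)" .
qed (simp add: SG_ne)

lemma refl_SG_in_SG [simp, intro]: "x \<in> SG \<Longrightarrow> refl_SG x \<in> SG"
  using refl_SG_image by blast

lemma sum_minus_3: "(\<Sum>i\<in>UNIV. g (- i)) = (\<Sum>i\<in>UNIV. g (i::3))" for g :: "3 \<Rightarrow> real"
  by (simp add: sum_UNIV_3 minus_3)

lemma continuous_on_comp_refl_SG: "continuous_on SG u \<Longrightarrow> continuous_on SG (u \<circ> refl_SG)"
  by (intro continuous_on_compose continuous_on_refl_SG) (simp add: refl_SG_image)

lemma energy_level_refl_SG: "energy_level m (u \<circ> refl_SG) (v \<circ> refl_SG) = energy_level m u v"
proof (induction m arbitrary: u v)
  case 0
  then show ?case by (simp add: energy_level_0 minus_3 algebra_simps)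
next
  case (Suc m)
  have "u \<circ> refl_SG \<circ> F i = u \<circ> F (- i) \<circ> refl_SG" for u :: "point \<Rightarrow> real" and i
    by (simp add: fun_eq_iff refl_SG_F del: split_paired_All)
  then have "energy_level m (u \<circ> refl_SG \<circ> F i) (v \<circ> refl_SG \<circ> F i)
    = energy_level m (u \<circ> F (- i)) (v \<circ> F (- i))" for i
    by (simp only: Suc.IH)
  then show ?case
    by (simp only: energy_level_Suc[of m] sum_minus_3[of "\<lambda>i. energy_level m (u \<circ> F i) (v \<circ> F i)"])
qed

lemma dom_energy_refl_SG: "u \<in> dom_energy \<Longrightarrow> u \<circ> refl_SG \<in> dom_energy"
  unfolding dom_energy_def mem_Collect_eq energy_level_refl_SG
  using continuous_on_comp_refl_SG by blast

lemma energy_refl_SG: "energy (u \<circ> refl_SG) (v \<circ> refl_SG) = energy u v"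
  unfolding energy_def by (simp add: energy_level_refl_SG)

subsection \<open>Integration\<close>

locale gasket_measure =
  fixes M :: "point measure"
  assumes sg_measure: "sg_measure M"
begin

lemma sets_M [measurable_cong]: "sets M = sets (restrict_space borel SG)"
  using sg_measure unfolding sg_measure_def by blast

sublocale prob_space M
  using sg_measure unfolding sg_measure_def by blast

lemma space_M: "space M = SG"
  using sets_eq_imp_space_eq[OF sets_M] by (simp add: space_restrict_space)

lemma AE_SG: "(\<And>x. x \<in> SG \<Longrightarrow> Q x) \<Longrightarrow> AE x in M. Q x"
  by (rule AE_I2) (simp add: space_M)

lemma measurable_continuous:
  fixes f :: "point \<Rightarrow> real"
  assumes "continuous_on SG f"
  shows "f \<in> borel_measurable M"
  using borel_measurable_continuous_on_restrict[OF assms] measurable_cong_sets[OF sets_M refl] by blast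

lemma measurable_F: "F i \<in> measurable M M"
proof -
  have "F i \<in> measurable M borel"
    using borel_measurable_continuous_on_restrict[OF continuous_on_F[of SG i]]
      measurable_cong_sets[OF sets_M refl] by blast
  then have "F i \<in> measurable M (restrict_space borel SG)"
    by (intro measurable_restrict_space2) (auto simp: space_M)
  then show ?thesis using measurable_cong_sets[OF refl sets_M] by blast
qed

lemma integrable_continuous:
  fixes f :: "point \<Rightarrow> real"
  assumes "continuous_on SG f"
  shows "integrable M f"
proof -
  obtain B where "\<And>x. x \<in> SG \<Longrightarrow> \<bar>f x\<bar> \<le> B"
    using compact_imp_bounded[OF compact_continuous_image[OF assms SG_compact]]
    by (auto simp: bounded_iff)
  then show ?thesis
    by (intro integrable_const_bound[of _ B] measurable_continuous assms AE_SG) simp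
qed

lemma emeasure_F:
  assumes "A \<in> sets M"
  shows "emeasure M A = (\<Sum>i\<in>UNIV. ennreal (1/3) * emeasure M (F i -` A \<inter> space M))"
proof -
  have "measure M A = (\<Sum>i\<in>UNIV. (1/3) * measure M (F i -` A \<inter> SG))"
    using sg_measure assms unfolding sg_measure_def by blast
  then have "ennreal (measure M A) = (\<Sum>i\<in>UNIV. ennreal ((1/3) * measure M (F i -` A \<inter> SG)))"
    by (simp only: sum_ennreal mult_nonneg_nonneg measure_nonneg divide_nonneg_nonneg zero_le_one zero_le_numeral)
  also have "\<dots> = (\<Sum>i\<in>UNIV. ennreal (1/3) * ennreal (measure M (F i -` A \<inter> SG)))"
    by (intro sum.cong refl ennreal_mult) auto
  finally show ?thesis by (simp only: emeasure_eq_measure space_M)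
qed

text \<open>Self-similarity is assumed for sets; the induction over measurable functions carries it
  to integrals.\<close>

lemma nn_integral_F:
  assumes "f \<in> borel_measurable M"
  shows "(\<integral>\<^sup>+x. f x \<partial>M) = (\<Sum>i\<in>UNIV. ennreal (1/3) * (\<integral>\<^sup>+x. f (F i x) \<partial>M))"
  using assms
proof (induction rule: borel_measurable_induct)
  case (cong f g)
  have "(\<integral>\<^sup>+x. g (F i x) \<partial>M) = (\<integral>\<^sup>+x. f (F i x) \<partial>M)" for i
    by (rule nn_integral_cong) (use cong.hyps(3) in \<open>simp add: space_M\<close>)
  moreover have "(\<integral>\<^sup>+x. g x \<partial>M) = (\<integral>\<^sup>+x. f x \<partial>M)"
    by (rule nn_integral_cong) (use cong.hyps(3) in simp)
  ultimately show ?case using cong.IH by simp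
next
  case (set A)
  have "(\<integral>\<^sup>+x. indicator A (F i x) \<partial>M) = emeasure M (F i -` A \<inter> space M)" for i
  proof -
    have "(\<integral>\<^sup>+x. indicator A (F i x) \<partial>M) = (\<integral>\<^sup>+x. indicator (F i -` A \<inter> space M) x \<partial>M)"
      by (rule nn_integral_cong) (simp add: indicator_def)
    also have "\<dots> = emeasure M (F i -` A \<inter> space M)"
      by (rule nn_integral_indicator) (rule measurable_sets[OF measurable_F set.hyps])
    finally show ?thesis .
  qed
  then show ?case using emeasure_F[OF set.hyps] set.hyps by simp
next
  case (mult u c)
  have [measurable]: "(\<lambda>x. u (F i x)) \<in> borel_measurable M" for i
    by (rule measurable_compose[OF measurable_F mult.hyps(2)])
  show ?case
    by (simp add: nn_integral_cmult mult.hyps(2) mult.IH sum_distrib_left mult.left_commute)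
next
  case (add u v)
  have [measurable]: "(\<lambda>x. u (F i x)) \<in> borel_measurable M" "(\<lambda>x. v (F i x)) \<in> borel_measurable M" for i
    using measurable_compose[OF measurable_F] add.hyps(1,3) by blast+
  show ?case
    by (simp add: nn_integral_add add.hyps(1,3) add.IH sum.distrib distrib_left)
next
  case (seq U)
  have m [measurable]: "(\<lambda>x. U n (F i x)) \<in> borel_measurable M" for n i
    by (rule measurable_compose[OF measurable_F seq.hyps(1)])
  have inc: "incseq (\<lambda>n x. U n (F i x))" for i
    using seq.hyps(3) by (simp add: incseq_def le_fun_def del: split_paired_All)
  have "(\<integral>\<^sup>+x. (SUP n. U n) x \<partial>M) = (SUP n. \<integral>\<^sup>+x. U n x \<partial>M)"
    using nn_integral_monotone_convergence_SUP[OF seq.hyps(3,1)] by (simp add: image_image)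
  also have "\<dots> = (SUP n. \<Sum>i\<in>UNIV. ennreal (1/3) * (\<integral>\<^sup>+x. U n (F i x) \<partial>M))"
    by (simp only: seq.IH)
  also have "\<dots> = (\<Sum>i\<in>UNIV. SUP n. ennreal (1/3) * (\<integral>\<^sup>+x. U n (F i x) \<partial>M))"
    by (rule ennreal_SUP_sum)
      (use inc in \<open>auto simp: incseq_def le_fun_def intro!: mult_left_mono nn_integral_mono\<close>)
  also have "\<dots> = (\<Sum>i\<in>UNIV. ennreal (1/3) * (\<integral>\<^sup>+x. (SUP n. U n) (F i x) \<partial>M))"
  proof (rule sum.cong[OF refl])
    fix i :: 3
    have "(SUP n. ennreal (1/3) * (\<integral>\<^sup>+x. U n (F i x) \<partial>M)) = ennreal (1/3) * (SUP n. \<integral>\<^sup>+x. U n (F i x) \<partial>M)"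
      by (simp add: SUP_mult_left_ennreal)
    also have "(SUP n. \<integral>\<^sup>+x. U n (F i x) \<partial>M) = (\<integral>\<^sup>+x. (SUP n. U n (F i x)) \<partial>M)"
      by (rule nn_integral_monotone_convergence_SUP[OF inc m, symmetric])
    finally show "(SUP n. ennreal (1/3) * (\<integral>\<^sup>+x. U n (F i x) \<partial>M))
      = ennreal (1/3) * (\<integral>\<^sup>+x. (SUP n. U n) (F i x) \<partial>M)" by (simp add: image_image)
  qed
  finally show ?case .
qed

lemma integral_F_nonneg:
  fixes f :: "point \<Rightarrow> real"
  assumes "continuous_on SG f" "\<And>x. x \<in> SG \<Longrightarrow> f x \<ge> 0"
  shows "(\<integral>x. f x \<partial>M) = 1/3 * (\<Sum>i\<in>UNIV. \<integral>x. f (F i x) \<partial>M)"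
proof -
  have int: "integrable M (\<lambda>x. f (F i x))" for i
    using integrable_continuous[OF continuous_on_comp_F[OF assms(1), of i]] by (simp add: o_def)
  have nn: "0 \<le> (\<integral>x. f (F i x) \<partial>M)" for i
    by (rule integral_nonneg_AE[OF AE_SG]) (simp add: assms(2))
  have "ennreal (\<integral>x. f x \<partial>M) = (\<integral>\<^sup>+x. ennreal (f x) \<partial>M)"
    by (rule nn_integral_eq_integral[symmetric]) (simp_all add: integrable_continuous assms AE_SG)
  also have "\<dots> = (\<Sum>i\<in>UNIV. ennreal (1/3) * (\<integral>\<^sup>+x. ennreal (f (F i x)) \<partial>M))"
    by (rule nn_integral_F) (intro measurable_compose[OF measurable_continuous[OF assms(1)]] measurable_ennreal)
  also have "\<dots> = (\<Sum>i\<in>UNIV. ennreal (1/3) * ennreal (\<integral>x. f (F i x) \<partial>M))"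
    by (intro sum.cong refl arg_cong2[of _ _ _ _ "(*)"] nn_integral_eq_integral int AE_SG)
      (simp add: assms(2))
  also have "\<dots> = ennreal (\<Sum>i\<in>UNIV. 1/3 * (\<integral>x. f (F i x) \<partial>M))"
    using nn by (simp add: ennreal_mult[symmetric] sum_ennreal del: times_divide_eq_left)
  finally have "(\<integral>x. f x \<partial>M) = (\<Sum>i\<in>UNIV. 1/3 * (\<integral>x. f (F i x) \<partial>M))"
    using nn by (subst (asm) ennreal_inj)
      (simp_all add: sum_nonneg integral_nonneg_AE[OF AE_SG] assms(2))
  then show ?thesis by (simp add: sum_distrib_left)
qed

lemma integral_F:
  fixes f :: "point \<Rightarrow> real"
  assumes "continuous_on SG f"
  shows "(\<integral>x. f x \<partial>M) = 1/3 * (\<Sum>i\<in>UNIV. \<integral>x. f (F i x) \<partial>M)"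
proof -
  obtain B where B: "\<And>x. x \<in> SG \<Longrightarrow> \<bar>f x\<bar> \<le> B"
    using compact_imp_bounded[OF compact_continuous_image[OF assms SG_compact]]
    by (auto simp: bounded_iff)
  have int: "integrable M (\<lambda>x. f (F i x))" for i
    using integrable_continuous[OF continuous_on_comp_F[OF assms, of i]] by (simp add: o_def)
  \<comment> \<open>Adding the bound \<open>B\<close> makes the integrand nonnegative. The constant
    contributes equally to both sides, since \<open>M\<close> is a probability measure and the three
    weights 1/3 add up to 1.\<close>
  have "(\<integral>x. f x + B \<partial>M) = 1/3 * (\<Sum>i\<in>UNIV. \<integral>x. f (F i x) + B \<partial>M)"
  proof (rule integral_F_nonneg)
    show "continuous_on SG (\<lambda>x. f x + B)" by (intro continuous_on_add continuous_on_const assms)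
    show "0 \<le> f x + B" if "x \<in> SG" for x using B[OF that] by linarith
  qed
  then show ?thesis
    by (simp add: int integrable_continuous[OF assms] prob_space sum_UNIV_3)
qed

text \<open>The reflection permutes the cells of level \<open>m\<close>, all of equal weight, so
  only the oscillation of \<open>f\<close> inside the cells is left as an error. Letting it tend to
  0 gives the invariance of the measure.\<close>

lemma integral_refl_SG_diff_le:
  fixes f :: "point \<Rightarrow> real"
  assumes "continuous_on SG f"
    "\<And>w x y. length w = m \<Longrightarrow> x \<in> SG \<Longrightarrow> y \<in> SG \<Longrightarrow> \<bar>f (F_word w x) - f (F_word w y)\<bar> \<le> e"
  shows "\<bar>(\<integral>x. f (refl_SG x) \<partial>M) - (\<integral>x. f x \<partial>M)\<bar> \<le> e"
  using assms
proof (induction m arbitrary: f)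
  case 0
  have i1: "integrable M f" and i2: "integrable M (\<lambda>x. f (refl_SG x))"
    using integrable_continuous[OF 0(1)] integrable_continuous[OF continuous_on_comp_refl_SG[OF 0(1)]]
    by (simp_all add: o_def)
  have "\<bar>\<integral>x. f (refl_SG x) - f x \<partial>M\<bar> \<le> (\<integral>x. \<bar>f (refl_SG x) - f x\<bar> \<partial>M)"
    by (rule integral_abs_bound)
  also have "\<dots> \<le> (\<integral>x. e \<partial>M)"
    by (rule integral_mono) (use i1 i2 0(2)[of "[]"] in \<open>auto simp: space_M\<close>)
  finally show ?case using i1 i2 by (simp add: prob_space)
next
  case (Suc m)
  have c: "continuous_on SG (f \<circ> F i)" for i by (rule continuous_on_comp_F[OF Suc.prems(1)])
  have IH: "\<bar>(\<integral>x. f (F i (refl_SG x)) \<partial>M) - (\<integral>x. f (F i x) \<partial>M)\<bar> \<le> e" for i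
    using Suc.IH[OF c[of i]] Suc.prems(2)[of "i # _"] by (simp add: o_def del: split_paired_All)
  have "(\<integral>x. f (refl_SG x) \<partial>M) = 1/3 * (\<Sum>i\<in>UNIV. \<integral>x. f (refl_SG (F i x)) \<partial>M)"
    using integral_F[OF continuous_on_comp_refl_SG[OF Suc.prems(1)]] by (simp add: o_def)
  also have "\<dots> = 1/3 * (\<Sum>i\<in>UNIV. \<integral>x. f (F i (refl_SG x)) \<partial>M)"
    unfolding refl_SG_F by (subst sum_minus_3) (rule refl)
  finally have "(\<integral>x. f (refl_SG x) \<partial>M) - (\<integral>x. f x \<partial>M)
     = 1/3 * (\<Sum>i\<in>UNIV. (\<integral>x. f (F i (refl_SG x)) \<partial>M) - (\<integral>x. f (F i x) \<partial>M))"
    by (simp add: integral_F[OF Suc.prems(1)] sum_subtractf right_diff_distrib)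
  also have "\<bar>\<dots>\<bar> \<le> e"
    using IH[of 0] IH[of 1] IH[of 2] by (simp add: sum_UNIV_3)
  finally show ?case .
qed

lemma integral_refl_SG:
  fixes f :: "point \<Rightarrow> real"
  assumes "continuous_on SG f"
  shows "(\<integral>x. f (refl_SG x) \<partial>M) = (\<integral>x. f x \<partial>M)"
proof -
  \<comment> \<open>The summand 0 gives the bound the shape that \<open>field_le_epsilon\<close>
    expects.\<close>
  have "\<bar>(\<integral>x. f (refl_SG x) \<partial>M) - (\<integral>x. f x \<partial>M)\<bar> \<le> 0 + e" if "e > 0" for e
  proof -
    obtain m where "\<And>w x y. length w = m \<Longrightarrow> x \<in> SG \<Longrightarrow> y \<in> SG \<Longrightarrow> \<bar>f (F_word w x) - f (F_word w y)\<bar> < e"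
      using cell_oscillation[OF assms \<open>e > 0\<close>] by blast
    then have "\<bar>(\<integral>x. f (refl_SG x) \<partial>M) - (\<integral>x. f x \<partial>M)\<bar> \<le> e"
      by (intro integral_refl_SG_diff_le[OF assms, of m]) (simp add: less_imp_le)
    then show ?thesis by simp
  qed
  then have "\<bar>(\<integral>x. f (refl_SG x) \<partial>M) - (\<integral>x. f x \<partial>M)\<bar> \<le> 0" by (rule field_le_epsilon)
  then show ?thesis by simp
qed

text \<open>The lower bound on the 2-cell of the word 0, 1 is brought to all of \<open>SG\<close> by
  two uses of \<open>integral_F\<close>, the other cells contributing nonnegatively.\<close>

lemma integral_bump_pos: "(\<integral>x. bump x \<partial>M) > 0"
proof -
  have c: "continuous_on SG bump" using bump_dom_energy by (simp add: dom_energy_def)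
  have c1: "continuous_on SG (\<lambda>x. bump (F i x))" for i
    using continuous_on_comp_F[OF c] by (simp add: o_def)
  have c2: "continuous_on SG (\<lambda>x. bump (F i (F j x)))" for i j
    using continuous_on_comp_F[OF c1] by (simp add: o_def)
  have n1: "0 \<le> (\<integral>x. bump (F i x) \<partial>M)" for i
    by (rule integral_nonneg_AE[OF AE_SG]) (simp add: bump_nonneg)
  have n2: "0 \<le> (\<integral>x. bump (F i (F j x)) \<partial>M)" for i j
    by (rule integral_nonneg_AE[OF AE_SG]) (simp add: bump_nonneg)
  have "2/25 = (\<integral>x. (2/25 :: real) \<partial>M)" by (simp add: prob_space)
  also have "\<dots> \<le> (\<integral>x. bump (F 0 (F 1 x)) \<partial>M)"
    by (rule integral_mono) (simp_all only: space_M bump_ge integrable_const integrable_continuous[OF c2])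
  finally have "0 < (\<integral>x. bump (F 0 (F 1 x)) \<partial>M)" by simp
  then have "0 < (\<integral>x. bump (F 0 x) \<partial>M)"
    unfolding integral_F[OF c1[of 0]] sum_UNIV_3 using n2[of 0 0] n2[of 0 2] by simp
  then show ?thesis
    unfolding integral_F[OF c] sum_UNIV_3 using n1[of 1] n1[of 2] by simp
qed

end


subsection \<open>The Laplacian\<close>

context gasket_measure
begin

lemma has_laplacian_cong:
  assumes "has_laplacian M u f" "\<And>x. x \<in> SG \<Longrightarrow> u x = u' x" "\<And>x. x \<in> SG \<Longrightarrow> f x = f' x"
  shows "has_laplacian M u' f'"
proof -
  have "u' \<in> dom_energy"
    using assms(1) dom_energy_cong[of u u'] assms(2) by (simp add: has_laplacian_def)
  moreover have "continuous_on SG f'"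
    using assms(1) continuous_on_cong[of SG SG f f'] assms(3) by (simp add: has_laplacian_def)
  moreover have "energy u' v = - (\<integral>x. f' x * v x \<partial>M)" if "v \<in> dom_energy" "\<forall>x\<in>V0. v x = 0" for v
  proof -
    have "energy u' v = energy u v" by (rule energy_cong) (simp_all add: assms)
    also have "\<dots> = - (\<integral>x. f x * v x \<partial>M)" using assms(1) that by (simp add: has_laplacian_def)
    also have "(\<integral>x. f x * v x \<partial>M) = (\<integral>x. f' x * v x \<partial>M)"
      by (rule Bochner_Integration.integral_cong[OF refl]) (simp add: space_M assms(3))
    finally show ?thesis .
  qed
  ultimately show ?thesis by (simp add: has_laplacian_def)
qed

lemma has_laplacian_lincomb:
  assumes "has_laplacian M u f" "has_laplacian M v g"
  shows "has_laplacian M (\<lambda>x. a * u x + b * v x) (\<lambda>x. a * f x + b * g x)"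
  unfolding has_laplacian_def
proof (intro conjI ballI impI)
  have u: "u \<in> dom_energy" "continuous_on SG f" and v: "v \<in> dom_energy" "continuous_on SG g"
    using assms by (auto simp: has_laplacian_def)
  show "(\<lambda>x. a * u x + b * v x) \<in> dom_energy" by (rule dom_energy_lincomb[OF u(1) v(1)])
  show "continuous_on SG (\<lambda>x. a * f x + b * g x)"
    by (intro continuous_on_add continuous_on_mult continuous_on_const u v)
  fix w assume w: "w \<in> dom_energy" "\<forall>x\<in>V0. w x = 0"
  then have cw: "continuous_on SG w" by (simp add: dom_energy_def)
  have "energy (\<lambda>x. a * u x + b * v x) w = a * energy u w + b * energy v w"
    by (rule energy_lincomb[OF u(1) v(1) w(1)])
  also have "\<dots> = - (a * (\<integral>x. f x * w x \<partial>M) + b * (\<integral>x. g x * w x \<partial>M))"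
    using assms w by (simp add: has_laplacian_def)
  also have "a * (\<integral>x. f x * w x \<partial>M) + b * (\<integral>x. g x * w x \<partial>M) =
      (\<integral>x. a * (f x * w x) + b * (g x * w x) \<partial>M)"
    using integrable_continuous[OF continuous_on_mult[OF u(2) cw]]
      integrable_continuous[OF continuous_on_mult[OF v(2) cw]]
    by simp
  finally show "energy (\<lambda>x. a * u x + b * v x) w = - (\<integral>x. (a * f x + b * g x) * w x \<partial>M)"
    by (simp add: algebra_simps)
qed

lemma has_laplacian_zero: "has_laplacian M (\<lambda>x. 0) (\<lambda>x. 0)"
  by (rule has_laplacian_cong[OF has_laplacian_harmonic[of M "\<lambda>i. 0"]])
    (use harmonic_le[of "\<lambda>i. 0" 0] harmonic_ge[of 0 "\<lambda>i. 0"] in \<open>auto intro!: antisym\<close>)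

lemma has_laplacian_sum:
  assumes "\<And>i. i \<in> I \<Longrightarrow> has_laplacian M (u i) (f i)" "finite I"
  shows "has_laplacian M (\<lambda>x. \<Sum>i\<in>I. a i * u i x) (\<lambda>x. \<Sum>i\<in>I. a i * f i x)"
  using assms(2,1)
proof (induction rule: finite_induct)
  case (insert i I)
  then have "has_laplacian M (\<lambda>x. a i * u i x + 1 * (\<Sum>i\<in>I. a i * u i x))
      (\<lambda>x. a i * f i x + 1 * (\<Sum>i\<in>I. a i * f i x))"
    by (intro has_laplacian_lincomb) auto
  then show ?case using insert.hyps by simp
qed (simp add: has_laplacian_zero)

text \<open>The factor 1/5 is 3/5, from the energy, times 1/3, from the measure. A test function for
  the cell becomes one for \<open>SG\<close> by extension with 0, for which gluing is used.\<close>

lemma has_laplacian_F: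
  assumes "has_laplacian M u f"
  shows "has_laplacian M (u \<circ> F i) (\<lambda>x. f (F i x) / 5)"
  unfolding has_laplacian_def
proof (intro conjI ballI impI)
  have u: "u \<in> dom_energy" and f: "continuous_on SG f" using assms by (auto simp: has_laplacian_def)
  show "u \<circ> F i \<in> dom_energy" by (rule dom_energy_comp_F[OF u])
  show "continuous_on SG (\<lambda>x. f (F i x) / 5)"
    using continuous_on_comp_F[OF f, of i] by (intro continuous_on_divide) (simp_all add: o_def)
  fix v assume v: "v \<in> dom_energy" "\<forall>x\<in>V0. v x = 0"
  define g where "g = (\<lambda>j. if j = i then v else (\<lambda>x. 0 :: real))"
  define w where "w = glue g"
  have z: "(\<lambda>x. 0 :: real) \<in> dom_energy" using has_laplacian_zero by (simp add: has_laplacian_def)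
  have gq: "g i (q j) = 0" for i j using v(2) by (auto simp: g_def)
  have wF: "w (F j x) = g j x" if "x \<in> SG" for j x
    unfolding w_def by (rule glue_F[OF _ that]) (simp add: gq)
  have w: "w \<in> dom_energy" unfolding w_def
    by (rule glue_dom_energy) (use v(1) z gq in \<open>auto simp: g_def\<close>)
  then have cw: "continuous_on SG w" by (simp add: dom_energy_def)
  have "w (q j) = 0" for j using wF[of "q j" j] by (simp add: gq)
  then have wV: "\<forall>x\<in>V0. w x = 0" by (auto simp: V0_def)
  have e0: "energy h (\<lambda>x. 0) = 0" for h
    by (rule energy_eqI) (simp add: energy_level_def)
  have "energy (u \<circ> F j) (w \<circ> F j) = (if j = i then energy (u \<circ> F i) v else 0)" for j
  proof -
    have "energy (u \<circ> F j) (w \<circ> F j) = energy (u \<circ> F j) (g j)"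
      by (rule energy_cong) (simp_all add: wF)
    then show ?thesis by (simp add: g_def e0)
  qed
  then have "energy u w = 5/3 * energy (u \<circ> F i) v"
    by (simp add: energy_comp_F[OF u w])
  moreover have "energy u w = - (\<integral>x. f x * w x \<partial>M)"
    using assms w wV by (simp add: has_laplacian_def)
  moreover have "(\<integral>x. f (F j x) * w (F j x) \<partial>M) = (if j = i then \<integral>x. f (F i x) * v x \<partial>M else 0)" for j
  proof -
    have "(\<integral>x. f (F j x) * w (F j x) \<partial>M) = (\<integral>x. f (F j x) * g j x \<partial>M)"
      by (rule Bochner_Integration.integral_cong[OF refl]) (simp add: space_M wF)
    then show ?thesis by (simp add: g_def)
  qed
  then have "(\<integral>x. f x * w x \<partial>M) = 1/3 * (\<integral>x. f (F i x) * v x \<partial>M)"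
    by (simp add: integral_F[OF continuous_on_mult[OF f cw]])
  ultimately show "energy (u \<circ> F i) v = - (\<integral>x. f (F i x) / 5 * v x \<partial>M)" by simp
qed

lemma has_laplacian_F_word:
  assumes "has_laplacian M u f"
  shows "has_laplacian M (u \<circ> F_word w) (\<lambda>x. f (F_word w x) / 5 ^ length w)"
  using assms
proof (induction w arbitrary: u f)
  case (Cons i w)
  from Cons.IH[OF has_laplacian_F[OF Cons.prems, of i]] show ?case
    by (simp add: o_assoc mult.commute)
qed simp

text \<open>If the Laplacian of 0 were positive somewhere, testing on a small cell against a copy of
  the bump would give a contradiction.\<close>

lemma laplacian_zero_nonpos:
  assumes "has_laplacian M (\<lambda>x. 0) e" "x \<in> SG"
  shows "e x \<le> 0"
proof (rule ccontr)
  assume "\<not> e x \<le> 0"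
  define d where "d = e x / 2"
  have pos: "d > 0" using \<open>\<not> e x \<le> 0\<close> by (simp add: d_def)
  have e: "continuous_on SG e" using assms(1) by (simp add: has_laplacian_def)
  obtain m where m: "\<And>w x y. length w = m \<Longrightarrow> x \<in> SG \<Longrightarrow> y \<in> SG \<Longrightarrow> \<bar>e (F_word w x) - e (F_word w y)\<bar> < d"
    using cell_oscillation[OF e pos] by blast
  obtain w z where w: "length w = m" "z \<in> SG" "x = F_word w z" using SG_cell[OF assms(2)] by blast
  have ge: "e (F_word w y) \<ge> d" if "y \<in> SG" for y
    using m[OF w(1) w(2) that] w(3) by (simp add: d_def abs_if split: if_splits)
  define E where "E = (\<lambda>x. e (F_word w x) / 5 ^ m)"
  have L: "has_laplacian M (\<lambda>x. 0) E"
    using has_laplacian_F_word[OF assms(1), of w] by (simp add: o_def E_def w(1))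
  then have cE: "continuous_on SG E" by (simp add: has_laplacian_def)
  have cb: "continuous_on SG bump" using bump_dom_energy by (simp add: dom_energy_def)
  have "energy (\<lambda>x. 0) bump = - (\<integral>x. E x * bump x \<partial>M)"
    using L bump_dom_energy by (auto simp: has_laplacian_def V0_def)
  moreover have "energy (\<lambda>x. 0) bump = 0"
    by (rule energy_eqI) (simp add: energy_level_def)
  ultimately have "(\<integral>x. E x * bump x \<partial>M) = 0" by simp
  moreover have "(\<integral>y. d / 5 ^ m * bump y \<partial>M) \<le> (\<integral>y. E y * bump y \<partial>M)"
  proof (rule integral_mono)
    show "integrable M (\<lambda>y. d / 5 ^ m * bump y)" "integrable M (\<lambda>y. E y * bump y)"
      by (intro integrable_continuous continuous_on_mult continuous_on_const cE cb)+
    fix y assume "y \<in> space M"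
    then have "y \<in> SG" by (simp add: space_M)
    then show "d / 5 ^ m * bump y \<le> E y * bump y"
      unfolding E_def by (intro mult_right_mono divide_right_mono ge bump_nonneg) simp_all
  qed
  moreover have "0 < d / 5 ^ m * (\<integral>y. bump y \<partial>M)"
    using pos integral_bump_pos by (intro mult_pos_pos divide_pos_pos) simp_all
  ultimately show False by simp
qed

text \<open>The difference is a Laplacian of the zero function, and the one-sided bound applies with
  either order of \<open>f\<close> and \<open>g\<close>.\<close>

lemma laplacian_unique:
  assumes "has_laplacian M u f" "has_laplacian M u g" "x \<in> SG"
  shows "f x = g x"
proof -
  have *: "f x \<le> g x" if "has_laplacian M u f" "has_laplacian M u g" for f g
    using laplacian_zero_nonpos[OF _ assms(3), of "\<lambda>x. 1 * f x + (- 1) * g x"]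
      has_laplacian_lincomb[OF that, of 1 "- 1"] by simp
  show ?thesis using *[OF assms(1,2)] *[OF assms(2,1)] by simp
qed

text \<open>Uniqueness on \<open>SG\<close> and the normalisation off \<open>SG\<close> leave
  exactly one candidate, so the definite description denotes a true Laplacian as soon as one
  exists.\<close>

lemma has_laplacian_laplacian:
  assumes "has_laplacian M u f"
  shows "has_laplacian M u (laplacian M u)"
proof -
  define f' where "f' = (\<lambda>x. if x \<in> SG then f x else 0)"
  have f': "has_laplacian M u f'"
    by (rule has_laplacian_cong[OF assms]) (simp_all add: f'_def)
  have "has_laplacian M u (laplacian M u) \<and> (\<forall>x. x \<notin> SG \<longrightarrow> laplacian M u x = 0)"
    unfolding laplacian_def
  proof (rule theI[where a = f'])
    show "has_laplacian M u f' \<and> (\<forall>x. x \<notin> SG \<longrightarrow> f' x = 0)"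
      using f' by (simp add: f'_def)
    fix g assume g: "has_laplacian M u g \<and> (\<forall>x. x \<notin> SG \<longrightarrow> g x = 0)"
    show "g = f'"
    proof (rule ext)
      fix x show "g x = f' x"
        using g laplacian_unique[of u g f' x] f' by (cases "x \<in> SG") (simp_all add: f'_def del: split_paired_All)
    qed
  qed
  then show ?thesis by blast
qed

lemma laplacian_eq:
  assumes "has_laplacian M u f" "x \<in> SG"
  shows "laplacian M u x = f x"
  by (rule laplacian_unique[OF has_laplacian_laplacian[OF assms(1)] assms])

text \<open>Energy and measure are both invariant, and a reflected test function still vanishes on
  \<open>V0\<close>, whose points are permuted.\<close>

lemma has_laplacian_refl_SG:
  assumes "has_laplacian M u f"
  shows "has_laplacian M (u \<circ> refl_SG) (f \<circ> refl_SG)"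
  unfolding has_laplacian_def
proof (intro conjI ballI impI)
  have u: "u \<in> dom_energy" and f: "continuous_on SG f" using assms by (auto simp: has_laplacian_def)
  show "u \<circ> refl_SG \<in> dom_energy" by (rule dom_energy_refl_SG[OF u])
  show "continuous_on SG (f \<circ> refl_SG)" by (rule continuous_on_comp_refl_SG[OF f])
  fix v assume v: "v \<in> dom_energy" "\<forall>x\<in>V0. v x = 0"
  have v': "v \<circ> refl_SG \<in> dom_energy" by (rule dom_energy_refl_SG[OF v(1)])
  then have cv: "continuous_on SG (v \<circ> refl_SG)" by (simp add: dom_energy_def)
  have "energy (u \<circ> refl_SG) v = energy (u \<circ> refl_SG) (v \<circ> refl_SG \<circ> refl_SG)"
    by (simp add: comp_assoc) (simp add: comp_def)
  also have "\<dots> = energy u (v \<circ> refl_SG)" by (rule energy_refl_SG)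
  also have "\<dots> = - (\<integral>x. f x * (v \<circ> refl_SG) x \<partial>M)"
    using assms v' v(2) by (auto simp: has_laplacian_def V0_def)
  also have "(\<integral>x. f x * (v \<circ> refl_SG) x \<partial>M) = (\<integral>x. f (refl_SG x) * (v \<circ> refl_SG) (refl_SG x) \<partial>M)"
    by (rule integral_refl_SG[OF continuous_on_mult[OF f cv], symmetric])
  finally show "energy (u \<circ> refl_SG) v = - (\<integral>x. (f \<circ> refl_SG) x * v x \<partial>M)"
    by (simp only: o_apply refl_SG_invol comp_def)
qed

end

subsection \<open>Jets at the top vertex\<close>

lemma F_funpow_in_SG: "x \<in> SG \<Longrightarrow> (F i ^^ m) x \<in> SG"
  by (induction m) auto

lemma has_normal_deriv_0_iff:
  "has_normal_deriv u 0 d \<longleftrightarrow>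
     (\<lambda>m. (5/3) ^ m * (2 * u (q 0) - u ((F 0 ^^ m) (q 1)) - u ((F 0 ^^ m) (q 2)))) \<longlonglongrightarrow> d"
  by (simp add: has_normal_deriv_def minus_3)

lemma has_tangential_deriv_0_iff:
  "has_tangential_deriv u 0 d \<longleftrightarrow>
     (\<lambda>m. 5 ^ m * (u ((F 0 ^^ m) (q 1)) - u ((F 0 ^^ m) (q 2)))) \<longlonglongrightarrow> d"
  by (simp add: has_tangential_deriv_def minus_3)

lemma has_normal_deriv_0_cong:
  assumes "has_normal_deriv u 0 d" "\<And>x. x \<in> SG \<Longrightarrow> u x = v x"
  shows "has_normal_deriv v 0 d"
  using assms(1) unfolding has_normal_deriv_0_iff by (simp add: assms(2) F_funpow_in_SG)

lemma has_tangential_deriv_0_cong: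
  assumes "has_tangential_deriv u 0 d" "\<And>x. x \<in> SG \<Longrightarrow> u x = v x"
  shows "has_tangential_deriv v 0 d"
  using assms(1) unfolding has_tangential_deriv_0_iff by (simp add: assms(2) F_funpow_in_SG)

lemma has_normal_deriv_0_lincomb:
  assumes "has_normal_deriv u 0 d" "has_normal_deriv v 0 d'"
  shows "has_normal_deriv (\<lambda>x. a * u x + b * v x) 0 (a * d + b * d')"
proof -
  have "(\<lambda>m. a * ((5/3) ^ m * (2 * u (q 0) - u ((F 0 ^^ m) (q 1)) - u ((F 0 ^^ m) (q 2))))
    + b * ((5/3) ^ m * (2 * v (q 0) - v ((F 0 ^^ m) (q 1)) - v ((F 0 ^^ m) (q 2))))) \<longlonglongrightarrow> a * d + b * d'"
    using assms unfolding has_normal_deriv_0_iff by (intro tendsto_intros)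
  then show ?thesis unfolding has_normal_deriv_0_iff by (simp add: algebra_simps)
qed

lemma has_tangential_deriv_0_lincomb:
  assumes "has_tangential_deriv u 0 d" "has_tangential_deriv v 0 d'"
  shows "has_tangential_deriv (\<lambda>x. a * u x + b * v x) 0 (a * d + b * d')"
proof -
  have "(\<lambda>m. a * (5 ^ m * (u ((F 0 ^^ m) (q 1)) - u ((F 0 ^^ m) (q 2))))
    + b * (5 ^ m * (v ((F 0 ^^ m) (q 1)) - v ((F 0 ^^ m) (q 2))))) \<longlonglongrightarrow> a * d + b * d'"
    using assms unfolding has_tangential_deriv_0_iff by (intro tendsto_intros)
  then show ?thesis unfolding has_tangential_deriv_0_iff by (simp add: algebra_simps)
qed

lemma refl_SG_F_funpow: "refl_SG ((F 0 ^^ m) x) = (F 0 ^^ m) (refl_SG x)"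
  by (induction m) (simp_all add: refl_SG_F)

lemma has_normal_deriv_0_refl_SG:
  "has_normal_deriv u 0 d \<Longrightarrow> has_normal_deriv (u \<circ> refl_SG) 0 d"
  unfolding has_normal_deriv_0_iff by (simp add: refl_SG_F_funpow minus_3 algebra_simps)

lemma has_tangential_deriv_0_refl_SG:
  assumes "has_tangential_deriv u 0 d"
  shows "has_tangential_deriv (u \<circ> refl_SG) 0 (- d)"
  using tendsto_minus[OF assms[unfolded has_tangential_deriv_0_iff]]
  unfolding has_tangential_deriv_0_iff by (simp add: refl_SG_F_funpow minus_3 algebra_simps)

lemma harmonic_F_funpow:
  "x \<in> SG \<Longrightarrow> harmonic a ((F 0 ^^ m) x) = harmonic ((harmonic_step 0 ^^ m) a) x"
proof (induction m arbitrary: a)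
  case (Suc m)
  then show ?case
    by (simp only: funpow.simps o_apply harmonic_F[OF F_funpow_in_SG[OF Suc.prems]] Suc.IH)
      (simp add: funpow_swap1)
qed simp

text \<open>The subdivision rule at \<open>q 0\<close> multiplies \<open>2 * a 0 - a 1 - a 2\<close>
  by 3/5, so the defining sequence is constant.\<close>

lemma has_normal_deriv_harmonic: "has_normal_deriv (harmonic a) 0 (2 * a 0 - a 1 - a 2)"
proof -
  have "((harmonic_step 0 ^^ m) a) 0 = a 0 \<and>
    (5/3) ^ m * (2 * a 0 - ((harmonic_step 0 ^^ m) a) 1 - ((harmonic_step 0 ^^ m) a) 2)
      = 2 * a 0 - a 1 - a 2" for m
    by (induction m) (simp_all add: harmonic_step_def field_simps)
  then show ?thesis unfolding has_normal_deriv_0_iff by (simp add: harmonic_F_funpow)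
qed

text \<open>Here the antisymmetric part \<open>a 1 - a 2\<close> is multiplied by 1/5 in each step,
  and the sequence is again constant.\<close>

lemma has_tangential_deriv_harmonic: "has_tangential_deriv (harmonic a) 0 (a 1 - a 2)"
proof -
  have "5 ^ m * (((harmonic_step 0 ^^ m) a) 1 - ((harmonic_step 0 ^^ m) a) 2) = a 1 - a 2" for m
    by (induction m) (simp_all add: harmonic_step_def field_simps)
  then show ?thesis unfolding has_tangential_deriv_0_iff by (simp add: harmonic_F_funpow)
qed

lemma has_normal_deriv_0_unique:
  "has_normal_deriv u 0 d \<Longrightarrow> has_normal_deriv u 0 d' \<Longrightarrow> d = d'"
  unfolding has_normal_deriv_0_iff by (rule LIMSEQ_unique)

lemma has_tangential_deriv_0_unique:
  "has_tangential_deriv u 0 d \<Longrightarrow> has_tangential_deriv u 0 d' \<Longrightarrow> d = d'"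
  unfolding has_tangential_deriv_0_iff by (rule LIMSEQ_unique)

lemma normal_deriv_0_eq: "has_normal_deriv u 0 d \<Longrightarrow> normal_deriv u 0 = d"
  unfolding normal_deriv_def by (rule the_equality) (auto dest: has_normal_deriv_0_unique)


subsection \<open>Estimates in the mean square norm\<close>

context gasket_measure
begin

text \<open>Cauchy-Schwarz, from the nonnegative quadratic in \<open>t\<close> given by the squared
  norm of \<open>f + t * g\<close>.\<close>

lemma inner_L2_le:
  assumes f: "continuous_on SG f" and g: "continuous_on SG g"
  shows "(inner_L2 M f g)\<^sup>2 \<le> inner_L2 M f f * inner_L2 M g g"
proof -
  define A B C where "A = inner_L2 M f f" "B = inner_L2 M f g" "C = inner_L2 M g g"
  have quad: "0 \<le> A + 2 * t * B + t\<^sup>2 * C" for t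
  proof -
    have "0 \<le> (\<integral>x. (f x + t * g x)\<^sup>2 \<partial>M)" by (rule integral_nonneg_AE) simp
    also have "\<dots> = (\<integral>x. f x * f x + 2 * t * (f x * g x) + t\<^sup>2 * (g x * g x) \<partial>M)"
      by (simp add: power2_eq_square algebra_simps)
    also have "\<dots> = A + 2 * t * B + t\<^sup>2 * C"
      unfolding A_B_C_def inner_L2_def
      using integrable_continuous[OF continuous_on_mult[OF f f]]
        integrable_continuous[OF continuous_on_mult[OF f g]]
        integrable_continuous[OF continuous_on_mult[OF g g]] by simp
    finally show ?thesis .
  qed
  have C: "C \<ge> 0" unfolding A_B_C_def inner_L2_def by (rule integral_nonneg_AE) simp
  have "B\<^sup>2 \<le> A * C"
  proof (cases "C = 0")
    case True
    have "B = 0"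
    proof (rule ccontr)
      assume "B \<noteq> 0"
      \<comment> \<open>With \<open>C = 0\<close> the quadratic is affine, and this \<open>t\<close>
        gives it the value -1.\<close>
      then have "2 * (- (A + 1) / (2 * B)) * B = - (A + 1)" by (simp add: field_simps)
      then show False using quad[of "- (A + 1) / (2 * B)"] True by simp
    qed
    then show ?thesis using True by simp
  next
    case False
    \<comment> \<open>The quadratic is evaluated at its minimiser; multiplying by \<open>C\<close>
      clears the denominator.\<close>
    then have "0 \<le> (A + 2 * (- B / C) * B + (- B / C)\<^sup>2 * C) * C"
      using quad C by (intro mult_nonneg_nonneg)
    also have "\<dots> = A * C - B\<^sup>2" using False by (simp add: power2_eq_square field_simps)
    finally show ?thesis by simp
  qed
  then show ?thesis by (simp add: A_B_C_def)
qed

lemma inner_L2_self_nonneg: "inner_L2 M f f \<ge> 0"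
  unfolding inner_L2_def by (rule integral_nonneg_AE) simp

lemma norm_L2_power2: "(norm_L2 M f)\<^sup>2 = inner_L2 M f f"
  by (simp add: norm_L2_def inner_L2_self_nonneg)

lemma norm_L2_nonneg: "norm_L2 M f \<ge> 0"
  by (simp add: norm_L2_def inner_L2_self_nonneg)

lemma inner_L2_add_self:
  assumes f: "continuous_on SG f" and g: "continuous_on SG g"
  shows "inner_L2 M (\<lambda>x. f x + g x) (\<lambda>x. f x + g x)
    = inner_L2 M f f + 2 * inner_L2 M f g + inner_L2 M g g"
proof -
  have "inner_L2 M (\<lambda>x. f x + g x) (\<lambda>x. f x + g x)
     = (\<integral>x. f x * f x + 2 * (f x * g x) + g x * g x \<partial>M)"
    by (simp add: inner_L2_def algebra_simps)
  then show ?thesis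
    unfolding inner_L2_def
    using integrable_continuous[OF continuous_on_mult[OF f f]]
      integrable_continuous[OF continuous_on_mult[OF f g]]
      integrable_continuous[OF continuous_on_mult[OF g g]] by simp
qed

lemma norm_L2_triangle:
  assumes "continuous_on SG f" "continuous_on SG g"
  shows "norm_L2 M (\<lambda>x. f x + g x) \<le> norm_L2 M f + norm_L2 M g"
proof (rule power2_le_imp_le)
  have "(inner_L2 M f g)\<^sup>2 \<le> (norm_L2 M f * norm_L2 M g)\<^sup>2"
    using inner_L2_le[OF assms] by (simp add: norm_L2_power2 power_mult_distrib)
  then have "\<bar>inner_L2 M f g\<bar> \<le> norm_L2 M f * norm_L2 M g"
    by (simp add: abs_le_square_iff[symmetric] norm_L2_nonneg abs_mult)
  then show "(norm_L2 M (\<lambda>x. f x + g x))\<^sup>2 \<le> (norm_L2 M f + norm_L2 M g)\<^sup>2"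
    by (simp add: norm_L2_power2 inner_L2_add_self[OF assms] power2_sum)
qed (simp add: norm_L2_nonneg)

lemma inner_L2_cong:
  assumes "\<And>x. x \<in> SG \<Longrightarrow> f x = f' x" "\<And>x. x \<in> SG \<Longrightarrow> g x = g' x"
  shows "inner_L2 M f g = inner_L2 M f' g'"
  unfolding inner_L2_def by (rule Bochner_Integration.integral_cong[OF refl]) (simp add: space_M assms)

lemma norm_L2_cong:
  assumes "\<And>x. x \<in> SG \<Longrightarrow> f x = f' x"
  shows "norm_L2 M f = norm_L2 M f'"
  unfolding norm_L2_def by (simp add: inner_L2_cong[OF assms assms])

lemma norm_L2_le_bound:
  assumes f: "continuous_on SG f" and "\<And>x. x \<in> SG \<Longrightarrow> \<bar>f x\<bar> \<le> B" "B \<ge> 0"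
  shows "norm_L2 M f \<le> B"
proof (rule power2_le_imp_le[OF _ assms(3)])
  have "inner_L2 M f f \<le> (\<integral>x. B\<^sup>2 \<partial>M)"
    unfolding inner_L2_def
  proof (rule integral_mono)
    fix x assume "x \<in> space M"
    then show "f x * f x \<le> B\<^sup>2"
      using assms(2)[of x] power_mono[of "\<bar>f x\<bar>" B 2] by (simp add: space_M power2_eq_square)
  qed (simp_all add: integrable_continuous continuous_on_mult f)
  then show "(norm_L2 M f)\<^sup>2 \<le> B\<^sup>2" by (simp add: norm_L2_power2 prob_space)
qed

text \<open>The plane is second countable, so pairing two Borel measurable maps is Borel measurable;
  hence the identity is measurable from \<open>M \<Otimes>\<^sub>M M\<close> to the Borel sets of
  \<open>SG \<times> SG\<close>.\<close>

lemma measurable_pair_continuous: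
  fixes K :: "point \<times> point \<Rightarrow> real"
  assumes "continuous_on (SG \<times> SG) K"
  shows "K \<in> borel_measurable (M \<Otimes>\<^sub>M M)"
proof -
  have "id \<in> borel_measurable M"
    using borel_measurable_continuous_on_restrict[OF continuous_on_id'[of SG]]
      measurable_cong_sets[OF sets_M refl] by (auto simp: id_def)
  then have id [measurable]: "(\<lambda>x. x) \<in> borel_measurable M" by (simp add: id_def)
  have "(\<lambda>z. (fst z, snd z)) \<in> borel_measurable (M \<Otimes>\<^sub>M M)"
    by (intro borel_measurable_Pair measurable_compose[OF measurable_fst id]
      measurable_compose[OF measurable_snd id])
  then have "(\<lambda>z. z) \<in> measurable (M \<Otimes>\<^sub>M M) (restrict_space borel (SG \<times> SG))"
    by (intro measurable_restrict_space2) (simp_all add: space_pair_measure space_M)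
  from measurable_compose[OF this borel_measurable_continuous_on_restrict[OF assms]]
  show ?thesis .
qed

text \<open>The Hilbert-Schmidt bound: Cauchy-Schwarz in \<open>y\<close> for each \<open>x\<close>,
  then integration in \<open>x\<close> and Fubini.\<close>

lemma norm_L2_integral_operator_le:
  assumes K: "continuous_on (SG \<times> SG) (\<lambda>(x, y). K x y)" and g: "continuous_on SG g"
    and u: "continuous_on SG u" "\<And>x. x \<in> SG \<Longrightarrow> u x = (\<integral>y. K x y * g y \<partial>M)"
  shows "norm_L2 M u \<le> green_norm M K * norm_L2 M g"
proof -
  interpret P: pair_prob_space M M ..
  have Kx: "continuous_on SG (K x)" if "x \<in> SG" for x
  proof -
    have "continuous_on SG ((\<lambda>(x, y). K x y) \<circ> (\<lambda>y. (x, y)))"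
      by (rule continuous_on_compose) (use that in \<open>auto intro!: continuous_intros continuous_on_subset[OF K]\<close>)
    then show ?thesis by (simp add: o_def)
  qed
  have K2: "continuous_on (SG \<times> SG) (\<lambda>z. (case z of (x, y) \<Rightarrow> K x y)\<^sup>2)"
    by (intro continuous_on_power K)
  have "compact ((\<lambda>z. (case z of (x, y) \<Rightarrow> K x y)\<^sup>2) ` (SG \<times> SG))"
    by (rule compact_continuous_image[OF K2 compact_Times[OF SG_compact SG_compact]])
  then have "bounded ((\<lambda>z. (case z of (x, y) \<Rightarrow> K x y)\<^sup>2) ` (SG \<times> SG))"
    by (rule compact_imp_bounded)
  then obtain B where "\<forall>v\<in>(\<lambda>z. (case z of (x, y) \<Rightarrow> K x y)\<^sup>2) ` (SG \<times> SG). norm v \<le> B"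
    unfolding bounded_iff by (elim exE)
  then have B: "norm ((case z of (x, y) \<Rightarrow> K x y)\<^sup>2) \<le> B" if "z \<in> SG \<times> SG" for z
    by (rule bspec[OF _ imageI[OF that]])
  have int: "integrable (M \<Otimes>\<^sub>M M) (\<lambda>(x, y). (K x y)\<^sup>2)"
  proof (rule P.P.integrable_const_bound[of _ B])
    show "AE z in M \<Otimes>\<^sub>M M. norm (case z of (x, y) \<Rightarrow> (K x y)\<^sup>2) \<le> B"
    proof (rule AE_I2)
      fix z assume "z \<in> space (M \<Otimes>\<^sub>M M)"
      then show "norm (case z of (x, y) \<Rightarrow> (K x y)\<^sup>2) \<le> B"
        using B[of z] by (simp add: space_pair_measure space_M case_prod_unfold)
    qed
    show "(\<lambda>(x, y). (K x y)\<^sup>2) \<in> borel_measurable (M \<Otimes>\<^sub>M M)"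
      using measurable_pair_continuous[OF K2] by (simp add: case_prod_unfold)
  qed
  have int1: "integrable M (\<lambda>x. \<integral>y. (K x y)\<^sup>2 \<partial>M)"
    by (rule P.integrable_fst[OF int])
  have fub: "(\<integral>x. (\<integral>y. (K x y)\<^sup>2 \<partial>M) \<partial>M) = (\<integral>(x, y). (K x y)\<^sup>2 \<partial>(M \<Otimes>\<^sub>M M))"
    by (rule P.integral_fst[OF int])
  have pt: "u x * u x \<le> (\<integral>y. (K x y)\<^sup>2 \<partial>M) * inner_L2 M g g" if "x \<in> SG" for x
    using inner_L2_le[OF Kx[OF that] g] u(2)[OF that] by (simp add: inner_L2_def power2_eq_square)
  have "inner_L2 M u u \<le> (\<integral>x. (\<integral>y. (K x y)\<^sup>2 \<partial>M) * inner_L2 M g g \<partial>M)"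
    unfolding inner_L2_def[of M u u]
    by (rule integral_mono)
      (use int1 pt in \<open>simp_all add: integrable_continuous continuous_on_mult u(1) space_M\<close>)
  also have "\<dots> = (\<integral>(x, y). (K x y)\<^sup>2 \<partial>(M \<Otimes>\<^sub>M M)) * inner_L2 M g g"
    by (simp add: fub)
  also have "\<dots> = (green_norm M K * norm_L2 M g)\<^sup>2"
  proof -
    have "0 \<le> (\<integral>(x, y). (K x y)\<^sup>2 \<partial>(M \<Otimes>\<^sub>M M))"
      by (rule integral_nonneg_AE) (simp add: case_prod_unfold)
    then show ?thesis by (simp add: power_mult_distrib norm_L2_power2 green_norm_def)
  qed
  finally have *: "(norm_L2 M u)\<^sup>2 \<le> (green_norm M K * norm_L2 M g)\<^sup>2"
    by (simp add: norm_L2_power2)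
  have "0 \<le> green_norm M K"
    unfolding green_norm_def by (intro real_sqrt_ge_zero integral_nonneg_AE) (simp add: case_prod_unfold)
  then show ?thesis by (intro power2_le_imp_le[OF *] mult_nonneg_nonneg norm_L2_nonneg)
qed

subsection \<open>The Sobolev inner product\<close>

text \<open>Frees later computations from the operator \<open>laplacian\<close>: any known Laplacian
  may stand in for it.\<close>

lemma inner_S_eq:
  assumes "has_laplacian M u f" "has_laplacian M v g"
  shows "inner_S M c u v = inner_L2 M u v + c * inner_L2 M f g"
proof -
  have "(\<integral>x. laplacian M u x * laplacian M v x \<partial>M) = (\<integral>x. f x * g x \<partial>M)"
    by (rule Bochner_Integration.integral_cong[OF refl])
      (simp add: space_M laplacian_eq[OF assms(1)] laplacian_eq[OF assms(2)])
  then show ?thesis by (simp add: inner_S_def inner_L2_def)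
qed

lemma inner_S_0: "inner_S M 0 u v = inner_L2 M u v"
  by (simp add: inner_S_def inner_L2_def)

lemma has_laplacian_continuous:
  "has_laplacian M u f \<Longrightarrow> continuous_on SG u" "has_laplacian M u f \<Longrightarrow> continuous_on SG f"
  by (simp_all add: has_laplacian_def dom_energy_def)

lemma inner_L2_sum_right:
  fixes u :: "nat \<Rightarrow> point \<Rightarrow> real"
  assumes "continuous_on SG r" "\<And>i. i < n \<Longrightarrow> continuous_on SG (u i)"
  shows "inner_L2 M r (\<lambda>x. \<Sum>i<n. a i * u i x) = (\<Sum>i<n. a i * inner_L2 M r (u i))"
proof -
  have i: "integrable M (\<lambda>x. r x * u i x)" if "i < n" for i
    by (intro integrable_continuous continuous_on_mult assms that)
  have "inner_L2 M r (\<lambda>x. \<Sum>i<n. a i * u i x) = (\<integral>x. (\<Sum>i<n. a i * (r x * u i x)) \<partial>M)"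
    by (simp add: inner_L2_def sum_distrib_left mult.left_commute)
  also have "\<dots> = (\<Sum>i<n. \<integral>x. a i * (r x * u i x) \<partial>M)"
    by (rule Bochner_Integration.integral_sum) (use i in simp)
  finally show ?thesis by (simp add: inner_L2_def)
qed

text \<open>Since \<open>inner_S M 0\<close> is the \<open>L\<^sup>2\<close> inner product, this covers both families of
  orthogonal polynomials.\<close>

lemma inner_S_minimal:
  fixes P L :: "nat \<Rightarrow> point \<Rightarrow> real"
  assumes P: "\<And>i. has_laplacian M (P i) (L i)" and c: "c \<ge> 0"
    and r: "\<And>x. x \<in> SG \<Longrightarrow> r x = P n x + (\<Sum>i<n. a i * P i x)"
    and orth: "\<And>m. m < n \<Longrightarrow> inner_S M c r (P m) = 0"
    and t: "\<And>x. x \<in> SG \<Longrightarrow> t x = P n x + (\<Sum>i<n. b i * P i x)"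
  shows "inner_S M c r r \<le> inner_S M c t t"
proof -
  have lap: "has_laplacian M (\<lambda>x. P n x + (\<Sum>i<n. a i * P i x)) (\<lambda>x. L n x + (\<Sum>i<n. a i * L i x))" for a
  proof -
    have "has_laplacian M (\<lambda>x. \<Sum>i<n. a i * P i x) (\<lambda>x. \<Sum>i<n. a i * L i x)"
      by (rule has_laplacian_sum) (simp_all add: P)
    from has_laplacian_lincomb[OF P[of n] this, of 1 1] show ?thesis by simp
  qed
  define d where "d = (\<lambda>x. \<Sum>i<n. (b i - a i) * P i x)"
  define e where "e = (\<lambda>x. \<Sum>i<n. (b i - a i) * L i x)"
  define s where "s = (\<lambda>x. L n x + (\<Sum>i<n. a i * L i x))"
  have hd: "has_laplacian M d e" unfolding d_def e_def by (rule has_laplacian_sum) (simp_all add: P)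
  have hr: "has_laplacian M r s" unfolding s_def by (rule has_laplacian_cong[OF lap[of a]]) (simp_all add: r)
  have ht: "has_laplacian M t (\<lambda>x. s x + e x)"
    by (rule has_laplacian_cong[OF lap[of b]])
      (simp_all add: t s_def e_def left_diff_distrib sum_subtractf)
  have td: "t x = r x + d x" if "x \<in> SG" for x
    using that by (simp add: r t d_def left_diff_distrib sum_subtractf)
  \<comment> \<open>The cross term between \<open>r\<close> and \<open>d = t - r\<close>. The
    correction \<open>d\<close> contains only monomials below \<open>n\<close>, so linearity reduces
    it to the vanishing products in \<open>orth\<close>.\<close>
  have "inner_L2 M r d + c * inner_L2 M s e
    = (\<Sum>i<n. (b i - a i) * (inner_L2 M r (P i) + c * inner_L2 M s (L i)))"
    unfolding d_def e_def
    using has_laplacian_continuous[OF P] has_laplacian_continuous[OF hr]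
    by (simp add: inner_L2_sum_right sum.distrib distrib_left sum_distrib_left mult.left_commute)
  also have "\<dots> = 0"
    by (rule sum.neutral) (use orth in \<open>simp add: inner_S_eq[OF hr P]\<close>)
  finally have 0: "inner_L2 M r d + c * inner_L2 M s e = 0" .
  have "inner_S M c t t = inner_L2 M (\<lambda>x. r x + d x) (\<lambda>x. r x + d x)
      + c * inner_L2 M (\<lambda>x. s x + e x) (\<lambda>x. s x + e x)"
    unfolding inner_S_eq[OF ht ht] by (simp add: inner_L2_cong[OF td td])
  also have "\<dots> = inner_S M c r r + 2 * (inner_L2 M r d + c * inner_L2 M s e)
      + (inner_L2 M d d + c * inner_L2 M e e)"
    unfolding inner_S_eq[OF hr hr]
      inner_L2_add_self[OF has_laplacian_continuous(1)[OF hr] has_laplacian_continuous(1)[OF hd]]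
      inner_L2_add_self[OF has_laplacian_continuous(2)[OF hr] has_laplacian_continuous(2)[OF hd]]
    by (simp add: distrib_left)
  finally show ?thesis using 0 c by (simp add: inner_L2_self_nonneg)
qed

end

subsection \<open>The Dirichlet problem and monomials\<close>

locale gasket_green = gasket_measure +
  fixes G :: "point \<Rightarrow> point \<Rightarrow> real"
  assumes green: "is_green M G"
begin

lemma green_iff:
  assumes "continuous_on SG f"
  shows "has_laplacian M u (\<lambda>x. - f x) \<and> (\<forall>x\<in>V0. u x = 0) \<longleftrightarrow>
    (\<forall>x\<in>SG. u x = (\<integral>y. G x y * f y \<partial>M))"
  using green[unfolded is_green_def, THEN conjunct2, THEN conjunct2, THEN spec, THEN spec, THEN mp, OF assms] .

lemma dirichlet_unique:
  assumes "has_laplacian M u f" "\<And>x. x \<in> SG \<Longrightarrow> f x = 0" "\<And>i. u (q i) = 0" "x \<in> SG"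
  shows "u x = 0"
proof -
  have "has_laplacian M u (\<lambda>x. - 0)" by (rule has_laplacian_cong[OF assms(1)]) (simp_all add: assms(2))
  moreover have "\<forall>x\<in>V0. u x = 0" using assms(3) by (auto simp: V0_def)
  ultimately have "\<forall>x\<in>SG. u x = (\<integral>y. G x y * 0 \<partial>M)"
    by (intro green_iff[THEN iffD1] conjI continuous_on_const)
  then show ?thesis using assms(4) by simp
qed

lemma eq_harmonic:
  assumes "has_laplacian M u f" "\<And>x. x \<in> SG \<Longrightarrow> f x = 0" "x \<in> SG"
  shows "u x = harmonic (\<lambda>i. u (q i)) x"
proof -
  let ?h = "harmonic (\<lambda>i. u (q i))"
  have "has_laplacian M (\<lambda>x. 1 * u x + (- 1) * ?h x) (\<lambda>x. 1 * f x + (- 1) * 0)"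
    by (rule has_laplacian_lincomb[OF assms(1) has_laplacian_harmonic])
  then have "1 * u x + (- 1) * ?h x = 0"
    by (rule dirichlet_unique[OF _ _ _ assms(3)]) (simp_all add: assms(2))
  then show ?thesis by simp
qed

text \<open>The difference is harmonic, and its value, normal derivative and tangential derivative
  at \<open>q 0\<close> are \<open>a 0\<close>, \<open>2 * a 0 - a 1 - a 2\<close> and
  \<open>a 1 - a 2\<close>. These determine the three boundary values.\<close>

lemma jet_unique:
  assumes u: "has_laplacian M u f" "has_normal_deriv u 0 d" "has_tangential_deriv u 0 t"
    and v: "has_laplacian M v g" "has_normal_deriv v 0 d" "has_tangential_deriv v 0 t"
    and fg: "\<And>x. x \<in> SG \<Longrightarrow> f x = g x" and uv: "u (q 0) = v (q 0)" and x: "x \<in> SG"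
  shows "u x = v x"
proof -
  define w where "w = (\<lambda>x. 1 * u x + (- 1) * v x)"
  define a where "a = (\<lambda>i. w (q i))"
  have w: "has_laplacian M w (\<lambda>x. 1 * f x + (- 1) * g x)"
    unfolding w_def by (rule has_laplacian_lincomb[OF u(1) v(1)])
  have wa: "w x = harmonic a x" if "x \<in> SG" for x
    unfolding a_def by (rule eq_harmonic[OF w _ that]) (simp add: fg)
  have "has_normal_deriv w 0 (1 * d + (- 1) * d)" "has_tangential_deriv w 0 (1 * t + (- 1) * t)"
    unfolding w_def by (intro has_normal_deriv_0_lincomb has_tangential_deriv_0_lincomb u v)+
  from has_normal_deriv_0_cong[OF this(1) wa] has_tangential_deriv_0_cong[OF this(2) wa]
  have "has_normal_deriv (harmonic a) 0 0" "has_tangential_deriv (harmonic a) 0 0" by simp_all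
  then have "2 * a 0 - a 1 - a 2 = 0" "a 1 - a 2 = 0"
    using has_normal_deriv_0_unique[OF has_normal_deriv_harmonic]
      has_tangential_deriv_0_unique[OF has_tangential_deriv_harmonic] by blast+
  moreover have "a 0 = 0" by (simp add: a_def w_def uv)
  ultimately have "a i = 0" for i using exhaust_3_cases[of i] by auto
  then have "harmonic a x = 0"
    using harmonic_le[of a 0 x] harmonic_ge[of 0 a x] x by simp
  then show ?thesis using wa[OF x] by (simp add: w_def)
qed

section \<open>Monomials: uniqueness, Laplacians and symmetry\<close>

lemma monomial_laplacian: "is_monomial M j k u \<Longrightarrow> has_laplacian M u (laplacian M u)"
  unfolding is_monomial_def using has_laplacian_laplacian by force

lemma monomial_jet:
  assumes "is_monomial M j k u"
  shows "u (q 0) = of_bool (j = 0 \<and> k = 1)" "has_normal_deriv u 0 (of_bool (j = 0 \<and> k = 2))"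
    "has_tangential_deriv u 0 (of_bool (j = 0 \<and> k = 3))"
  using assms unfolding is_monomial_def by (auto dest!: spec[of _ 0] simp: eq_commute[of 0])

lemma monomial_Suc:
  assumes "is_monomial M (Suc j) k u"
  shows "is_monomial M j k (laplacian M u)"
proof -
  have *: "(laplacian M ^^ n) (laplacian M u) = (laplacian M ^^ Suc n) u" for n
    by (simp add: funpow_swap1)
  show ?thesis
    using assms unfolding is_monomial_def *
    by (auto simp del: funpow.simps dest: spec[of _ "Suc _"])
qed

lemma monomial_eqI:
  assumes u: "is_monomial M j k u" and v: "is_monomial M j k v"
    and lap: "\<And>x. x \<in> SG \<Longrightarrow> laplacian M u x = laplacian M v x" and x: "x \<in> SG"
  shows "u x = v x"
proof (rule jet_unique[OF monomial_laplacian[OF u] monomial_jet(2,3)[OF u]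
    monomial_laplacian[OF v] monomial_jet(2,3)[OF v] lap _ x])
  show "u (q 0) = v (q 0)" by (simp only: monomial_jet(1)[OF u] monomial_jet(1)[OF v])
qed

lemma monomial_unique:
  assumes "is_monomial M j k u" "is_monomial M j k v" "x \<in> SG"
  shows "u x = v x"
  using assms
proof (induction j arbitrary: u v x)
  case 0
  have "laplacian M u x = laplacian M v x" if "x \<in> SG" for x
    using 0(1,2) that by (simp add: is_monomial_def)
  from monomial_eqI[OF 0(1,2) this 0(3)] show ?case .
next
  case (Suc j)
  have "laplacian M u x = laplacian M v x" if "x \<in> SG" for x
    by (rule Suc.IH[OF monomial_Suc[OF Suc.prems(1)] monomial_Suc[OF Suc.prems(2)] that])
  from monomial_eqI[OF Suc.prems(1,2) this Suc.prems(3)] show ?case .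
qed

lemma monomial_has_laplacian:
  assumes "is_monomial M (Suc j) k u" "is_monomial M j k v"
  shows "has_laplacian M u v"
  by (rule has_laplacian_cong[OF monomial_laplacian[OF assms(1)]])
    (simp_all add: monomial_unique[OF monomial_Suc[OF assms(1)] assms(2)])

lemma monomial_has_laplacian_0:
  assumes "is_monomial M 0 k u"
  shows "has_laplacian M u (\<lambda>x. 0)"
  by (rule has_laplacian_cong[OF monomial_laplacian[OF assms]])
    (use assms in \<open>simp_all add: is_monomial_def\<close>)

text \<open>The reflection keeps the value and the normal derivative at \<open>q 0\<close> and
  negates the tangential derivative. For \<open>k = 1\<close> the latter is 0, so \<open>u\<close>
  and its reflection have the same jet.\<close>

lemma monomial_refl_SGI:
  assumes u: "is_monomial M j 1 u"
    and lap: "\<And>x. x \<in> SG \<Longrightarrow> laplacian M u (refl_SG x) = laplacian M u x" and x: "x \<in> SG"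
  shows "u (refl_SG x) = u x"
proof -
  have n: "has_normal_deriv u 0 0" and t: "has_tangential_deriv u 0 0"
    using monomial_jet(2,3)[OF u] by simp_all
  have t': "has_tangential_deriv (u \<circ> refl_SG) 0 0"
    using has_tangential_deriv_0_refl_SG[OF t] by simp
  have "(u \<circ> refl_SG) x = u x"
    by (rule jet_unique[OF has_laplacian_refl_SG[OF monomial_laplacian[OF u]]
        has_normal_deriv_0_refl_SG[OF n] t' monomial_laplacian[OF u] n t _ _ x])
      (simp_all add: lap minus_3)
  then show ?thesis by simp
qed

lemma monomial_refl_SG:
  assumes "is_monomial M j 1 u" "x \<in> SG"
  shows "u (refl_SG x) = u x"
  using assms
proof (induction j arbitrary: u x)
  case 0
  have "laplacian M u (refl_SG x) = laplacian M u x" if "x \<in> SG" for x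
    using 0(1) that by (simp add: is_monomial_def)
  from monomial_refl_SGI[OF 0(1) this 0(2)] show ?case .
next
  case (Suc j)
  have "laplacian M u (refl_SG x) = laplacian M u x" if "x \<in> SG" for x
    by (rule Suc.IH[OF monomial_Suc[OF Suc.prems(1)] that])
  from monomial_refl_SGI[OF Suc.prems(1) this Suc.prems(2)] show ?case .
qed

end


subsection \<open>The norm estimates\<close>

lemma has_normal_deriv_0_sum:
  assumes "\<And>i. i \<in> I \<Longrightarrow> has_normal_deriv (u i) 0 (d i)" "finite I"
  shows "has_normal_deriv (\<lambda>x. \<Sum>i\<in>I. a i * u i x) 0 (\<Sum>i\<in>I. a i * d i)"
  using assms(2,1)
proof (induction rule: finite_induct)
  case empty
  then show ?case by (simp add: has_normal_deriv_0_iff)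
next
  case (insert i I)
  then have "has_normal_deriv (\<lambda>x. a i * u i x + 1 * (\<Sum>i\<in>I. a i * u i x)) 0
      (a i * d i + 1 * (\<Sum>i\<in>I. a i * d i))"
    by (intro has_normal_deriv_0_lincomb) auto
  then show ?case using insert.hyps by simp
qed

text \<open>The monic polynomial with Laplacian \<open>p\<close> differs from the solution \<open>f\<close> of the Dirichlet
  problem by a harmonic function, which vanishes at \<open>q 0\<close> and is symmetric, hence is determined
  by its normal derivative there.\<close>

lemma (in gasket_green) monic_antiderivative:
  fixes P :: "nat \<Rightarrow> point \<Rightarrow> real"
  assumes P: "\<And>j. is_monomial M j 1 (P j)"
    and p: "\<And>x. x \<in> SG \<Longrightarrow> p x = P m x + (\<Sum>i<m. a i * P i x)"
    and f: "\<And>x. x \<in> SG \<Longrightarrow> f x = - (\<integral>y. G x y * p y \<partial>M)"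
  defines "Q \<equiv> \<lambda>x. P (Suc m) x + (\<Sum>i<m. a i * P (Suc i) x)"
  shows "has_laplacian M Q p"
    and "inner_L2 M Q Q \<le> 2 * (green_norm M G)\<^sup>2 * inner_L2 M p p + (normal_deriv f 0)\<^sup>2"
    and "norm_L2 M Q \<le> green_norm M G * norm_L2 M p + \<bar>normal_deriv f 0\<bar>"
proof -
  have lP: "has_laplacian M (P (Suc j)) (P j)" for j by (rule monomial_has_laplacian[OF P P])
  have "has_laplacian M (\<lambda>x. \<Sum>i<m. a i * P (Suc i) x) (\<lambda>x. \<Sum>i<m. a i * P i x)"
    by (rule has_laplacian_sum) (simp_all add: lP)
  from has_laplacian_lincomb[OF lP[of m] this, of 1 1]
  have "has_laplacian M Q (\<lambda>x. P m x + (\<Sum>i<m. a i * P i x))" by (simp add: Q_def)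
  then show Qp: "has_laplacian M Q p" by (rule has_laplacian_cong) (simp_all add: p)
  have cp: "continuous_on SG p" by (rule has_laplacian_continuous(2)[OF Qp])
  then have cp': "continuous_on SG (\<lambda>x. - p x)" by (intro continuous_on_minus)
  have fG: "f x = (\<integral>y. G x y * - p y \<partial>M)" if "x \<in> SG" for x
    using f[OF that] by simp
  have f1: "has_laplacian M f (\<lambda>x. - (- p x))" and f0: "\<forall>x\<in>V0. f x = 0"
    using green_iff[OF cp', of f] fG by blast+
  define a' where "a' = (\<lambda>i. 1 * Q (q i) + (- 1) * f (q i))"
  have hl: "has_laplacian M (\<lambda>x. 1 * Q x + (- 1) * f x) (\<lambda>x. 1 * p x + (- 1) * (- (- p x)))"
    by (rule has_laplacian_lincomb[OF Qp f1])
  have h: "1 * Q x + (- 1) * f x = harmonic a' x" if "x \<in> SG" for x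
    unfolding a'_def by (rule eq_harmonic[OF hl _ that]) simp
  have fq: "f (q i) = 0" for i using f0 by (simp add: V0_def)
  \<comment> \<open>\<open>Q\<close> contains no multiple of \<open>P 0\<close>: the free constant
    of the antiderivative is chosen so that \<open>Q\<close> vanishes at \<open>q 0\<close>.\<close>
  have "Q (q 0) = 0" unfolding Q_def by (simp add: monomial_jet(1)[OF P])
  then have a0: "a' 0 = 0" by (simp add: a'_def fq)
  have "Q (refl_SG (q 1)) = Q (q 1)"
    unfolding Q_def by (simp only: monomial_refl_SG[OF P q_in_SG])
  then have a12: "a' 2 = a' 1" by (simp add: a'_def fq minus_3)
  have Qn: "has_normal_deriv Q 0 0"
  proof -
    have nP: "has_normal_deriv (P (Suc j)) 0 0" for j using monomial_jet(2)[OF P[of "Suc j"]] by simp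
    have "has_normal_deriv (\<lambda>x. \<Sum>i<m. a i * P (Suc i) x) 0 (\<Sum>i<m. a i * 0)"
      by (rule has_normal_deriv_0_sum) (simp_all add: nP)
    from has_normal_deriv_0_lincomb[OF nP[of m] this, of 1 1] show ?thesis by (simp add: Q_def)
  qed
  \<comment> \<open>On \<open>SG\<close> this function is \<open>f\<close>. As \<open>Q\<close>
    contributes 0 and \<open>a' 0 = 0\<close>, its derivative is minus that of the harmonic part,
    namely \<open>a' 1 + a' 2\<close>.\<close>
  have "has_normal_deriv (\<lambda>x. 1 * Q x + (- 1) * harmonic a' x) 0
      (1 * 0 + (- 1) * (2 * a' 0 - a' 1 - a' 2))"
    by (intro has_normal_deriv_0_lincomb Qn has_normal_deriv_harmonic)
  then have "has_normal_deriv f 0 (1 * 0 + (- 1) * (2 * a' 0 - a' 1 - a' 2))"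
    by (rule has_normal_deriv_0_cong) (simp flip: h)
  then have nd: "normal_deriv f 0 = 2 * a' 1"
    using a0 a12 by (simp add: normal_deriv_0_eq)
  have ai: "\<bar>a' i\<bar> \<le> \<bar>a' 1\<bar>" for i using exhaust_3_cases[of i] a0 a12 by auto
  have hb: "\<bar>harmonic a' x\<bar> \<le> \<bar>a' 1\<bar>" if "x \<in> SG" for x
    using harmonic_le[of a' "\<bar>a' 1\<bar>", OF _ that] harmonic_ge[of "- \<bar>a' 1\<bar>" a', OF _ that] ai
    by (simp add: abs_le_iff minus_le_iff)
  have hn: "norm_L2 M (harmonic a') \<le> \<bar>a' 1\<bar>"
    by (rule norm_L2_le_bound[OF continuous_on_harmonic hb]) auto
  have cf: "continuous_on SG f" by (rule has_laplacian_continuous(1)[OF f1])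
  have "norm_L2 M f \<le> green_norm M G * norm_L2 M (\<lambda>x. - p x)"
    by (rule norm_L2_integral_operator_le[OF _ cp' cf fG]) (use green in \<open>simp_all add: is_green_def\<close>)
  also have "norm_L2 M (\<lambda>x. - p x) = norm_L2 M p" by (simp add: norm_L2_def inner_L2_def)
  finally have fn: "norm_L2 M f \<le> green_norm M G * norm_L2 M p" .
  have "norm_L2 M Q = norm_L2 M (\<lambda>x. f x + harmonic a' x)"
    by (rule norm_L2_cong) (simp flip: h)
  also have "\<dots> \<le> norm_L2 M f + norm_L2 M (harmonic a')"
    by (rule norm_L2_triangle[OF cf continuous_on_harmonic])
  finally have tri: "norm_L2 M Q \<le> norm_L2 M f + norm_L2 M (harmonic a')" .
  then show "norm_L2 M Q \<le> green_norm M G * norm_L2 M p + \<bar>normal_deriv f 0\<bar>"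
    using fn hn by (simp add: nd)
  have "(norm_L2 M Q)\<^sup>2 \<le> (norm_L2 M f + norm_L2 M (harmonic a'))\<^sup>2"
    by (intro power_mono tri norm_L2_nonneg)
  \<comment> \<open>The source of the factor 2 before the Green norm. The harmonic part has norm at
    most half the absolute normal derivative of \<open>f\<close>, so twice its square stays below
    the square of that derivative.\<close>
  also have "\<dots> \<le> 2 * (norm_L2 M f)\<^sup>2 + 2 * (norm_L2 M (harmonic a'))\<^sup>2"
    using zero_le_power2[of "norm_L2 M f - norm_L2 M (harmonic a')"]
    by (simp add: power2_sum power2_diff)
  also have "\<dots> \<le> 2 * (green_norm M G * norm_L2 M p)\<^sup>2 + 2 * \<bar>a' 1\<bar>\<^sup>2"
    by (intro add_mono mult_left_mono power_mono fn hn norm_L2_nonneg) simp_all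
  also have "\<dots> \<le> 2 * (green_norm M G)\<^sup>2 * inner_L2 M p p + (normal_deriv f 0)\<^sup>2"
    by (simp add: nd power_mult_distrib norm_L2_power2)
  finally show "inner_L2 M Q Q \<le> 2 * (green_norm M G)\<^sup>2 * inner_L2 M p p + (normal_deriv f 0)\<^sup>2"
    by (simp add: norm_L2_power2)
qed

theorem proposition3p3:
  fixes \<mu> :: "point measure" and G :: "point \<Rightarrow> point \<Rightarrow> real"
    and P p s f :: "nat \<Rightarrow> point \<Rightarrow> real" and c :: real
  assumes c_pos: "c > 0"
    and \<mu>: "sg_measure \<mu>"
    and G: "is_green \<mu> G"
    and P: "\<And>j. is_monomial \<mu> j 1 (P j)"
    and p: "monic_orthogonal (inner_L2 \<mu>) P p"
    and s: "monic_orthogonal (inner_S \<mu> c) P s"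
    and f: "\<And>n x. n \<ge> 1 \<Longrightarrow> x \<in> SG \<Longrightarrow> f n x = - (\<integral>y. G x y * p (n - 1) y \<partial>\<mu>)"
  shows "\<forall>n\<ge>1.
     (norm_L2 \<mu> (p n))\<^sup>2 + c * (norm_L2 \<mu> (p (n - 1)))\<^sup>2 \<le> (norm_S \<mu> c (s n))\<^sup>2 \<and>
     (norm_S \<mu> c (s n))\<^sup>2 \<le> 2 * (green_norm \<mu> G)\<^sup>2 * (norm_L2 \<mu> (p (n - 1)))\<^sup>2
        + (normal_deriv (f n) 0)\<^sup>2 + c * (norm_L2 \<mu> (p (n - 1)))\<^sup>2 \<and>
     norm_L2 \<mu> (p n) \<le> norm_L2 \<mu> (s n) \<and>
     norm_L2 \<mu> (s n) \<le> green_norm \<mu> G * norm_L2 \<mu> (p (n - 1)) + \<bar>normal_deriv (f n) 0\<bar>"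
proof (intro allI impI)
  fix n :: nat assume "n \<ge> 1"
  then obtain m where n: "n = Suc m" by (cases n) auto
  interpret gasket_green \<mu> G by unfold_locales (rule \<mu> G)+
  have lP: "has_laplacian \<mu> (P (Suc j)) (P j)" for j by (rule monomial_has_laplacian[OF P P])
  \<comment> \<open>The Laplacians of the monomials: an index shift, with 0 in place of the monomial
    of index -1.\<close>
  define L where "L = (\<lambda>j. case j of 0 \<Rightarrow> (\<lambda>x. 0) | Suc i \<Rightarrow> P i)"
  have L: "has_laplacian \<mu> (P j) (L j)" for j
    using lP monomial_has_laplacian_0[OF P] by (cases j) (simp_all add: L_def)
  obtain a where a: "\<And>x. x \<in> SG \<Longrightarrow> p m x = P m x + (\<Sum>i<m. a i * P i x)"
    using p unfolding monic_orthogonal_def by blast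
  obtain a' where a': "\<And>x. x \<in> SG \<Longrightarrow> p n x = P n x + (\<Sum>i<n. a' i * P i x)"
    using p unfolding monic_orthogonal_def by blast
  obtain b where b: "\<And>x. x \<in> SG \<Longrightarrow> s n x = P n x + (\<Sum>i<n. b i * P i x)"
    using s unfolding monic_orthogonal_def by blast
  have orth_p: "inner_S \<mu> 0 (p k) (P i) = 0" if "i < k" for i k
    using p that unfolding monic_orthogonal_def inner_S_0 by blast
  have orth_s: "inner_S \<mu> c (s n) (P i) = 0" if "i < n" for i
    using s that unfolding monic_orthogonal_def by blast
  define Q where "Q = (\<lambda>x. P (Suc m) x + (\<Sum>i<m. a i * P (Suc i) x))"
  have fm: "f n x = - (\<integral>y. G x y * p m y \<partial>\<mu>)" if "x \<in> SG" for x
    using f[of n x] that n by simp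
  have Q1: "has_laplacian \<mu> Q (p m)"
    unfolding Q_def by (rule monic_antiderivative(1)[OF P a fm])
  have Q2: "inner_L2 \<mu> Q Q
      \<le> 2 * (green_norm \<mu> G)\<^sup>2 * inner_L2 \<mu> (p m) (p m) + (normal_deriv (f n) 0)\<^sup>2"
    unfolding Q_def by (rule monic_antiderivative(2)[OF P a fm])
  have Q3: "norm_L2 \<mu> Q \<le> green_norm \<mu> G * norm_L2 \<mu> (p m) + \<bar>normal_deriv (f n) 0\<bar>"
    unfolding Q_def by (rule monic_antiderivative(3)[OF P a fm])
  \<comment> \<open>The Laplacian of \<open>s n\<close>: the term of \<open>P 0\<close> drops out
    and the others move down by one index, so \<open>t\<close> is monic of degree
    \<open>m\<close>.\<close>
  define t where "t = (\<lambda>x. P m x + (\<Sum>i<m. b (Suc i) * P i x))"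
  have st: "has_laplacian \<mu> (s n) t"
  proof -
    have "has_laplacian \<mu> (\<lambda>x. \<Sum>i<n. b i * P i x) (\<lambda>x. \<Sum>i<n. b i * L i x)"
      by (rule has_laplacian_sum) (simp_all add: L)
    moreover have "(\<Sum>i<n. b i * L i x) = (\<Sum>i<m. b (Suc i) * P i x)" for x
      unfolding n sum.lessThan_Suc_shift by (simp add: L_def)
    ultimately have "has_laplacian \<mu> (\<lambda>x. \<Sum>i<n. b i * P i x) (\<lambda>x. \<Sum>i<m. b (Suc i) * P i x)"
      by simp
    from has_laplacian_lincomb[OF lP[of m] this, of 1 1]
    have "has_laplacian \<mu> (\<lambda>x. P n x + (\<Sum>i<n. b i * P i x)) t"
      by (simp add: t_def n del: sum.lessThan_Suc)
    then show ?thesis by (rule has_laplacian_cong) (simp_all add: b)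
  qed
  \<comment> \<open>Minimality of \<open>p m\<close>, with weight 0 for the Laplacian term, against
    the competitor \<open>t\<close>.\<close>
  have tp: "inner_L2 \<mu> (p m) (p m) \<le> inner_L2 \<mu> t t"
    using inner_S_minimal[OF L order_refl a orth_p, of t "\<lambda>i. b (Suc i)"]
    by (simp add: t_def inner_S_0)
  have sp: "inner_L2 \<mu> (p n) (p n) \<le> inner_L2 \<mu> (s n) (s n)"
    using inner_S_minimal[OF L order_refl a' orth_p b] by (simp add: inner_S_0)
  \<comment> \<open>\<open>Q\<close> as competitor for \<open>s n\<close>: the coefficient of
    \<open>P 0\<close> is 0, the others are those of \<open>p m\<close> shifted by one.\<close>
  have "Q x = P n x + (\<Sum>i<n. (case i of 0 \<Rightarrow> 0 | Suc i \<Rightarrow> a i) * P i x)" for x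
    unfolding Q_def n sum.lessThan_Suc_shift by simp
  then have "inner_S \<mu> c (s n) (s n) \<le> inner_S \<mu> c Q Q"
    by (intro inner_S_minimal[OF L less_imp_le[OF c_pos] b orth_s])
  then have sQ: "inner_L2 \<mu> (s n) (s n) + c * inner_L2 \<mu> t t
      \<le> inner_L2 \<mu> Q Q + c * inner_L2 \<mu> (p m) (p m)"
    unfolding inner_S_eq[OF st st] inner_S_eq[OF Q1 Q1] .
  have ctp: "c * inner_L2 \<mu> (p m) (p m) \<le> c * inner_L2 \<mu> t t"
    using tp c_pos by (intro mult_left_mono) simp_all
  \<comment> \<open>The Laplacian part of \<open>s n\<close> is at least that of \<open>Q\<close>,
    whose Laplacian is the minimal \<open>p m\<close>. So in the Sobolev comparison the remaining
    part, the mean square of \<open>s n\<close>, cannot exceed that of \<open>Q\<close>.\<close>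
  then have "inner_L2 \<mu> (s n) (s n) \<le> inner_L2 \<mu> Q Q" using sQ by simp
  then have "norm_L2 \<mu> (s n) \<le> norm_L2 \<mu> Q" by (simp add: norm_L2_def)
  moreover have "norm_L2 \<mu> (p n) \<le> norm_L2 \<mu> (s n)" using sp by (simp add: norm_L2_def)
  moreover have "(norm_S \<mu> c (s n))\<^sup>2 = inner_L2 \<mu> (s n) (s n) + c * inner_L2 \<mu> t t"
    using c_pos by (simp add: norm_S_def inner_S_eq[OF st st] inner_L2_self_nonneg)
  ultimately show "(norm_L2 \<mu> (p n))\<^sup>2 + c * (norm_L2 \<mu> (p (n - 1)))\<^sup>2 \<le> (norm_S \<mu> c (s n))\<^sup>2 \<and>
     (norm_S \<mu> c (s n))\<^sup>2 \<le> 2 * (green_norm \<mu> G)\<^sup>2 * (norm_L2 \<mu> (p (n - 1)))\<^sup>2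
        + (normal_deriv (f n) 0)\<^sup>2 + c * (norm_L2 \<mu> (p (n - 1)))\<^sup>2 \<and>
     norm_L2 \<mu> (p n) \<le> norm_L2 \<mu> (s n) \<and>
     norm_L2 \<mu> (s n) \<le> green_norm \<mu> G * norm_L2 \<mu> (p (n - 1)) + \<bar>normal_deriv (f n) 0\<bar>"
    using sp sQ ctp Q2 Q3 by (simp add: n norm_L2_power2)
qed

end
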